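(* Let $\Delta$ be a forest with vertices $x_1,\dots,x_n$, let $I\subset R=K[x_1,\dots,x_n]$ be its facet ideal, and let $r\ge 0$. Then $H_r(R/I)$ has a $K$-basis consisting of homology classes $[f e_{i_1}\wedge\cdots\wedge e_{i_r}]$ of monomial cycles $f e_{i_1}\wedge\cdots\wedge e_{i_r}$ of $K_\bullet(R/I)$.
   Context: A simplicial complex $\Delta$ on a finite vertex set is a collection of subsets containing all singletons and closed under taking subsets. Facets are the maximal faces and $\mathcal F(\Delta)$ is the set of facets. A subcomplex of $\Delta$ is a simplicial complex $\Gamma$ with $\mathcal F(\Gamma)\subseteq\mathcal F(\Delta)$. $\Delta$ is connected if for any two facets $F,G$ there are facets $F=F_0,\dots,F_m=G$ with $F_i\cap F_{i+1}\ne\emptyset$ for all $i$. A facet $F$ is a leaf of $\Delta$ if it is the only facet of $\Delta$, or there is a facet $G\ne F$ with $F\cap H\subseteq F\cap G$ for every facet $H\ne F$. A tree is a connected simplicial complex every nonempty subcomplex of which has a leaf; a forest is a simplicial complex all of whose connected components are trees. $K$ is a field and the vertices of $\Delta$ are identified with the variables $x_1,\dots,x_n$ of $R=K[x_1,\dots,x_n]$. The facet ideal of $\Delta$ is the ideal of $R$ generated by the squarefree monomials $x_{i_1}\cdots x_{i_s}$ with $\{x_{i_1},\dots,x_{i_s}\}$ a facet of $\Delta$. For an $R$-module $M$, $K_\bullet(M)$ is the Koszul complex of $M$ with respect to $x_1,\dots,x_n$, with exterior basis elements $e_1,\dots,e_n$ and $d(e_i)=x_i$; $H_\bullet(M)$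 is its homology. For a monomial ideal $I$, a cycle $z$ of $K_\bullet(R/I)$ is a monomial cycle if $z=fe_L$ for some monomial $f$ and some $L=\{i_1<\dots<i_r\}\subseteq\{1,\dots,n\}$, where $e_L=e_{i_1}\wedge\cdots\wedge e_{i_r}$. *)

theory Defs
  imports
    "HOL-Algebra.QuotRing"
    "HOL-Algebra.Algebraic_Closure_Type"
    "HOL-Library.Poly_Mapping"
    "Jordan_Normal_Form.Missing_VectorSpace"
begin

section \<open>Simplicial complexes, trees and forests\<close>

definition simplicial_complex :: "'v set \<Rightarrow> 'v set set \<Rightarrow> bool" where
  "simplicial_complex V \<Delta> \<longleftrightarrow>
     finite V \<and> \<Delta> \<subseteq> Pow V \<and> (\<forall>v\<in>V. {v} \<in> \<Delta>) \<and> (\<forall>F\<in>\<Delta>. \<forall>G. G \<subseteq> F \<longrightarrow> G \<in> \<Delta>)"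

definition facets :: "'v set set \<Rightarrow> 'v set set" where
  "facets \<Delta> = {F \<in> \<Delta>. \<forall>G\<in>\<Delta>. F \<subseteq> G \<longrightarrow> F = G}"

text \<open>A subcomplex is a complex on its own vertex set \<open>\<Union>\<Gamma>\<close>, which may be smaller than that
  of \<open>\<Delta>\<close>.\<close>

definition subcomplex :: "'v set set \<Rightarrow> 'v set set \<Rightarrow> bool" where
  "subcomplex \<Gamma> \<Delta> \<longleftrightarrow> simplicial_complex (\<Union>\<Gamma>) \<Gamma> \<and> facets \<Gamma> \<subseteq> facets \<Delta>"

definition connected_complex :: "'v set set \<Rightarrow> bool" where
  "connected_complex \<Delta> \<longleftrightarrow>
     (\<forall>F\<in>facets \<Delta>. \<forall>G\<in>facets \<Delta>. \<exists>(m::nat) H.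
        H 0 = F \<and> H m = G \<and> (\<forall>i\<le>m. H i \<in> facets \<Delta>) \<and> (\<forall>i<m. H i \<inter> H (Suc i) \<noteq> {}))"

definition leaf :: "'v set set \<Rightarrow> 'v set \<Rightarrow> bool" where
  "leaf \<Delta> F \<longleftrightarrow> F \<in> facets \<Delta> \<and>
     (facets \<Delta> = {F} \<or>
      (\<exists>G\<in>facets \<Delta>. G \<noteq> F \<and> (\<forall>H\<in>facets \<Delta>. H \<noteq> F \<longrightarrow> F \<inter> H \<subseteq> F \<inter> G)))"

definition simplicial_tree :: "'v set \<Rightarrow> 'v set set \<Rightarrow> bool" where
  "simplicial_tree V \<Delta> \<longleftrightarrow> simplicial_complex V \<Delta> \<and> connected_complex \<Delta> \<and>
     (\<forall>\<Gamma>. subcomplex \<Gamma> \<Delta> \<and> \<Gamma> \<noteq> {} \<longrightarrow> (\<exists>F. leaf \<Gamma> F))"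

text \<open>Connected components are the maximal connected subcomplexes.\<close>

definition connected_component :: "'v set set \<Rightarrow> 'v set set \<Rightarrow> bool" where
  "connected_component \<Delta> \<Gamma> \<longleftrightarrow> subcomplex \<Gamma> \<Delta> \<and> connected_complex \<Gamma> \<and>
     (\<forall>\<Gamma>'. subcomplex \<Gamma>' \<Delta> \<and> connected_complex \<Gamma>' \<and> \<Gamma> \<subseteq> \<Gamma>' \<longrightarrow> \<Gamma>' = \<Gamma>)"

definition simplicial_forest :: "'v set \<Rightarrow> 'v set set \<Rightarrow> bool" where
  "simplicial_forest V \<Delta> \<longleftrightarrow> simplicial_complex V \<Delta> \<and>
     (\<forall>\<Gamma>. connected_component \<Delta> \<Gamma> \<longrightarrow> simplicial_tree (\<Union>\<Gamma>) \<Gamma>)"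


section \<open>Polynomial rings and facet ideals\<close>

text \<open>A polynomial is a finitely supported map from exponent vectors to coefficients; the
  product on \<open>\<Rightarrow>\<^sub>0\<close> is convolution.  The type has all of \<open>'v\<close> as variables, so the carrier
  restricts to polynomials in the variables indexed by \<open>V\<close>.\<close>

type_synonym ('v, 'k) mpoly = "('v \<Rightarrow>\<^sub>0 nat) \<Rightarrow>\<^sub>0 'k"

definition mpoly_ring :: "'v set \<Rightarrow> ('v, 'k::field) mpoly ring" where
  "mpoly_ring V =
     ring_of_type_algebra\<lparr>carrier := {p. \<forall>a\<in>Poly_Mapping.keys p. Poly_Mapping.keys a \<subseteq> V}\<rparr>"

definition mconst :: "'k::field \<Rightarrow> ('v, 'k) mpoly" where
  "mconst c = Poly_Mapping.single 0 c"

definition mmonomial :: "('v \<Rightarrow>\<^sub>0 nat) \<Rightarrow> ('v, 'k::field) mpoly" where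
  "mmonomial a = Poly_Mapping.single a 1"

definition mvar :: "'v \<Rightarrow> ('v, 'k::field) mpoly" where
  "mvar i = mmonomial (Poly_Mapping.single i 1)"

definition facet_ideal :: "'v set \<Rightarrow> 'v set set \<Rightarrow> ('v, 'k::field) mpoly set" where
  "facet_ideal V \<Delta> = genideal (mpoly_ring V) ((\<lambda>F. \<Prod>i\<in>F. mvar i) ` facets \<Delta>)"


section \<open>Modules\<close>

text \<open>Module records extend ring records, so the constructions below have to fill the fields
  \<open>mult\<close> and \<open>one\<close>; these play no role in the module structure.\<close>

definition quotient_module ::
  "('r, 'm, 'e) module_scheme \<Rightarrow> 'm set \<Rightarrow> ('r, 'm set) module" where
  "quotient_module M N =
     \<lparr>carrier = a_rcosets\<^bsub>M\<^esub> N,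
      monoid.mult = (\<lambda>A B. N), one = N, ring.zero = N, add = set_add M,
      module.smult = (\<lambda>a A. \<Union>m\<in>A. N +>\<^bsub>M\<^esub> (a \<odot>\<^bsub>M\<^esub> m))\<rparr>"

definition quotient_ring_module ::
  "('r, 'e) ring_scheme \<Rightarrow> 'r set \<Rightarrow> ('r, 'r set) module" where
  "quotient_ring_module R I =
     \<lparr>carrier = carrier (R Quot I), monoid.mult = monoid.mult (R Quot I), one = one (R Quot I),
      ring.zero = ring.zero (R Quot I), add = add (R Quot I),
      module.smult = (\<lambda>a A. (I +>\<^bsub>R\<^esub> a) \<otimes>\<^bsub>R Quot I\<^esub> A)\<rparr>"

definition restrict_scalars ::
  "('s \<Rightarrow> 'r) \<Rightarrow> ('r, 'm, 'e) module_scheme \<Rightarrow> ('s, 'm) module" where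
  "restrict_scalars \<phi> M =
     \<lparr>carrier = carrier M, monoid.mult = monoid.mult M,
      one = one M, ring.zero = ring.zero M, add = add M,
      module.smult = (\<lambda>a m. \<phi> a \<odot>\<^bsub>M\<^esub> m)\<rparr>"


section \<open>The Koszul complex\<close>

text \<open>The total module of the Koszul complex of \<open>M\<close> is \<open>M\<close> tensored with the exterior algebra
  on the basis \<open>e\<^sub>i\<close>, \<open>i \<in> V\<close>.  Its element \<open>\<Sum>\<^sub>L m\<^sub>L e\<^sub>L\<close> is encoded as the
  function \<open>L \<mapsto> m\<^sub>L\<close> on the subsets of \<open>V\<close>, where \<open>e\<^sub>L\<close> is the wedge product of the
  \<open>e\<^sub>i\<close>, \<open>i \<in> L\<close>, in increasing order.\<close>

definition koszul :: "'v set \<Rightarrow> ('r, 'm, 'e) module_scheme \<Rightarrow> ('r, 'v set \<Rightarrow> 'm) module" where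
  "koszul V M =
     \<lparr>carrier = Pow V \<rightarrow>\<^sub>E carrier M,
      monoid.mult = (\<lambda>b c. \<lambda>L\<in>Pow V. \<zero>\<^bsub>M\<^esub>), one = (\<lambda>L\<in>Pow V. \<zero>\<^bsub>M\<^esub>),
      ring.zero = (\<lambda>L\<in>Pow V. \<zero>\<^bsub>M\<^esub>),
      add = (\<lambda>b c. \<lambda>L\<in>Pow V. b L \<oplus>\<^bsub>M\<^esub> c L),
      module.smult = (\<lambda>a c. \<lambda>L\<in>Pow V. a \<odot>\<^bsub>M\<^esub> c L)\<rparr>"

definition koszul_chains :: "'v set \<Rightarrow> ('r, 'm, 'e) module_scheme \<Rightarrow> nat \<Rightarrow> ('v set \<Rightarrow> 'm) set" where
  "koszul_chains V M r =
     {c \<in> carrier (koszul V M). \<forall>L\<in>Pow V. card L \<noteq> r \<longrightarrow> c L = \<zero>\<^bsub>M\<^esub>}"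

text \<open>For \<open>L = {i\<^sub>1 < \<dots> < i\<^sub>r}\<close> the differential sends \<open>m e\<^sub>L\<close> to the sum over \<open>k\<close> of
  \<open>(-1)\<^sup>k\<^sup>-\<^sup>1 x\<^bsub>i\<^sub>k\<^esub> m e\<^bsub>L - {i\<^sub>k}\<^esub>\<close>.  Hence the coefficient of \<open>e\<^sub>J\<close> in
  the image of \<open>c\<close> collects the contributions of the sets \<open>L = insert i J\<close> with
  \<open>i \<in> V - J\<close>.\<close>

definition koszul_diff ::
  "('r, 'f) ring_scheme \<Rightarrow> 'v::linorder set \<Rightarrow> ('v \<Rightarrow> 'r) \<Rightarrow> ('r, 'm, 'e) module_scheme \<Rightarrow>
     ('v set \<Rightarrow> 'm) \<Rightarrow> ('v set \<Rightarrow> 'm)" where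
  "koszul_diff R V x M c =
     (\<lambda>J\<in>Pow V. \<Oplus>\<^bsub>M\<^esub>i\<in>V - J.
        ((\<ominus>\<^bsub>R\<^esub> \<one>\<^bsub>R\<^esub>) [^]\<^bsub>R\<^esub> card {j\<in>J. j < i} \<otimes>\<^bsub>R\<^esub> x i) \<odot>\<^bsub>M\<^esub> c (insert i J))"

definition koszul_cycles ::
  "('r, 'f) ring_scheme \<Rightarrow> 'v::linorder set \<Rightarrow> ('v \<Rightarrow> 'r) \<Rightarrow> ('r, 'm, 'e) module_scheme \<Rightarrow>
     nat \<Rightarrow> ('v set \<Rightarrow> 'm) set" where
  "koszul_cycles R V x M r =
     {c \<in> koszul_chains V M r. koszul_diff R V x M c = \<zero>\<^bsub>koszul V M\<^esub>}"

definition koszul_boundaries ::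
  "('r, 'f) ring_scheme \<Rightarrow> 'v::linorder set \<Rightarrow> ('v \<Rightarrow> 'r) \<Rightarrow> ('r, 'm, 'e) module_scheme \<Rightarrow>
     nat \<Rightarrow> ('v set \<Rightarrow> 'm) set" where
  "koszul_boundaries R V x M r = koszul_diff R V x M ` koszul_chains V M (Suc r)"

definition koszul_homology ::
  "('r, 'f) ring_scheme \<Rightarrow> 'v::linorder set \<Rightarrow> ('v \<Rightarrow> 'r) \<Rightarrow> ('r, 'm, 'e) module_scheme \<Rightarrow>
     nat \<Rightarrow> ('r, ('v set \<Rightarrow> 'm) set) module" where
  "koszul_homology R V x M r =
     quotient_module ((koszul V M)\<lparr>carrier := koszul_cycles R V x M r\<rparr>)
       (koszul_boundaries R V x M r)"

definition koszul_class ::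
  "('r, 'f) ring_scheme \<Rightarrow> 'v::linorder set \<Rightarrow> ('v \<Rightarrow> 'r) \<Rightarrow> ('r, 'm, 'e) module_scheme \<Rightarrow>
     nat \<Rightarrow> ('v set \<Rightarrow> 'm) \<Rightarrow> ('v set \<Rightarrow> 'm) set" where
  "koszul_class R V x M r z = koszul_boundaries R V x M r +>\<^bsub>koszul V M\<^esub> z"

definition koszul_elem :: "'v set \<Rightarrow> ('r, 'm, 'e) module_scheme \<Rightarrow> 'm \<Rightarrow> 'v set \<Rightarrow> ('v set \<Rightarrow> 'm)" where
  "koszul_elem V M m L = (\<lambda>J\<in>Pow V. if J = L then m else \<zero>\<^bsub>M\<^esub>)"


section \<open>Koszul homology of a quotient of a polynomial ring\<close>

abbreviation quot_poly ::
  "'v set \<Rightarrow> ('v, 'k::field) mpoly set \<Rightarrow> (('v, 'k) mpoly, ('v, 'k) mpoly set) module" where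
  "quot_poly V I \<equiv> quotient_ring_module (mpoly_ring V) I"

definition monomial_cycles ::
  "'v::linorder set \<Rightarrow> ('v, 'k::field) mpoly set \<Rightarrow> nat \<Rightarrow> ('v set \<Rightarrow> ('v, 'k) mpoly set) set" where
  "monomial_cycles V I r =
     {koszul_elem V (quot_poly V I) (I +>\<^bsub>mpoly_ring V\<^esub> mmonomial a) L | a L.
        Poly_Mapping.keys a \<subseteq> V \<and> L \<subseteq> V \<and> card L = r \<and>
        koszul_elem V (quot_poly V I) (I +>\<^bsub>mpoly_ring V\<^esub> mmonomial a) L
          \<in> koszul_cycles (mpoly_ring V) V mvar (quot_poly V I) r}"

definition homology_space ::
  "'v::linorder set \<Rightarrow> ('v, 'k::field) mpoly set \<Rightarrow> nat \<Rightarrow>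
     ('k, ('v set \<Rightarrow> ('v, 'k) mpoly set) set) module" where
  "homology_space V I r =
     restrict_scalars mconst (koszul_homology (mpoly_ring V) V mvar (quot_poly V I) r)"

definition homology_class ::
  "'v::linorder set \<Rightarrow> ('v, 'k::field) mpoly set \<Rightarrow> nat \<Rightarrow>
     ('v set \<Rightarrow> ('v, 'k) mpoly set) \<Rightarrow> ('v set \<Rightarrow> ('v, 'k) mpoly set) set" where
  "homology_class V I r z = koszul_class (mpoly_ring V) V mvar (quot_poly V I) r z"

end

theory Submission
  imports Defs
begin

text \<open>
  Since a spanning set contains a basis, it suffices that the classes of monomial cycles span.
  In a forest every nonempty set of facets has a leaf, and this property survives both the
  removal of facets and the removal of vertices from all facets. It gives an induction on the
  number of generators: let \<open>F\<close> be a leaf, \<open>J\<close> the ideal of the other generators and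
  \<open>I = J + (x\<^sub>F)\<close>. If \<open>dc \<in> I K\<^sub>\<bullet>(R)\<close>, write \<open>dc = y + x\<^sub>F b\<close> with \<open>y \<in> J K\<^sub>\<bullet>(R)\<close>. Then \<open>b\<close> is a
  cycle modulo \<open>J : x\<^sub>F\<close>, whose generators are the \<open>x\<^bsub>H - F\<^esub>\<close>, so by induction \<open>b\<close> is a combination of
  monomial cycles \<open>f e\<^sub>L\<close> up to a boundary. A leaf has a vertex \<open>i\<close> lying in no other facet, and
  \<open>x\<^sub>F f e\<^sub>L\<close> is, modulo \<open>J\<close>, the boundary of the monomial cycle \<open>\<plusminus>(x\<^sub>F / x\<^sub>i) f e\<^sub>i \<and> e\<^sub>L\<close> modulo \<open>I\<close>.
  Subtracting these from \<open>c\<close> leaves a cycle modulo \<open>J\<close>. The induction starts with the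
  acyclicity of the Koszul complex of \<open>R\<close>.
\<close>

section \<open>Additive maps given on monomials\<close>

text \<open>Cycles modulo \<open>I\<close> are handled through lifts: chains stay in the Koszul
  complex of the polynomial ring, and a cycle is a chain whose differential has coefficients in
  \<open>I\<close>. All ideals involved are generated by squarefree monomials, so membership of a
  monomial depends only on its support, and any chain can be split along a set of basis elements.
  The quotient enters only in the final translation to homology.

  The obstacle is that the induction leaves the facets of a complex: the sets \<open>H - F\<close>
  generating the colon ideal can be nested. For the path with edges 12, 23, 34 and \<open>F\<close>
  = 12 they are 3 and 34, and the leaf 3 has no free vertex.

  The induction does not record the homological degree; projecting its result to degree
  \<open>r\<close> restores it. Coefficients lie in any commutative ring until a basis is
  extracted.\<close>

abbreviation (input) "keys \<equiv> Poly_Mapping.keys"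
abbreviation (input) "lookup \<equiv> Poly_Mapping.lookup"
abbreviation (input) "single \<equiv> Poly_Mapping.single"

definition supported_on :: "'a set \<Rightarrow> ('a \<Rightarrow>\<^sub>0 'b::zero) set" where
  "supported_on A = {c. keys c \<subseteq> A}"

lemma supported_on_iff: "c \<in> supported_on A \<longleftrightarrow> (\<forall>k. k \<notin> A \<longrightarrow> lookup c k = 0)"
  unfolding supported_on_def by (auto simp: in_keys_iff)

lemma supported_on_mono: "c \<in> supported_on A \<Longrightarrow> A \<subseteq> B \<Longrightarrow> c \<in> supported_on B"
  by (auto simp: supported_on_def)

lemma supported_on_zero [simp]: "0 \<in> supported_on A"
  by (simp add: supported_on_iff)

lemma supported_on_single [simp]: "k \<in> A \<Longrightarrow> single k s \<in> supported_on A"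
  by (auto simp: supported_on_def)

lemma supported_on_add: "c \<in> supported_on A \<Longrightarrow> d \<in> supported_on A \<Longrightarrow> c + d \<in> supported_on A"
  for c d :: "'a \<Rightarrow>\<^sub>0 'b::monoid_add"
  by (simp add: supported_on_iff lookup_add)

lemma supported_on_diff: "c \<in> supported_on A \<Longrightarrow> d \<in> supported_on A \<Longrightarrow> c - d \<in> supported_on A"
  for c d :: "'a \<Rightarrow>\<^sub>0 'b::ab_group_add"
  by (simp add: supported_on_iff lookup_minus)

lemma supported_on_uminus: "c \<in> supported_on A \<Longrightarrow> - c \<in> supported_on A"
  for c :: "'a \<Rightarrow>\<^sub>0 'b::ab_group_add"
  by (simp add: supported_on_iff)

lemma supported_on_sum:
  "(\<And>i. i \<in> S \<Longrightarrow> f i \<in> supported_on A) \<Longrightarrow> sum f S \<in> supported_on A"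
  for f :: "'i \<Rightarrow> 'a \<Rightarrow>\<^sub>0 'b::comm_monoid_add"
  by (simp add: supported_on_iff lookup_sum)

lemma poly_mapping_sum_single: "c = (\<Sum>k\<in>keys c. single k (lookup c k))"
  for c :: "'a \<Rightarrow>\<^sub>0 'b::comm_monoid_add"
proof (rule poly_mapping_eqI)
  fix x
  show "lookup c x = lookup (\<Sum>k\<in>keys c. single k (lookup c k)) x"
    by (auto simp: lookup_sum lookup_single when_def sum.delta in_keys_iff)
qed

text \<open>The coefficient is an argument of \<open>f\<close>, so that signs and shifts are built
  into \<open>f\<close> and only additivity in the coefficient is required; the target needs no
  scalar action.\<close>

definition lin :: "('a \<Rightarrow> 'b::zero \<Rightarrow> 'c::comm_monoid_add) \<Rightarrow> ('a \<Rightarrow>\<^sub>0 'b) \<Rightarrow> 'c" where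
  "lin f c = (\<Sum>k\<in>keys c. f k (lookup c k))"

lemma additive_lin:
  fixes f :: "'a \<Rightarrow> 'b::ab_group_add \<Rightarrow> 'c::ab_group_add"
  assumes "\<And>k. additive (f k)"
  shows "additive (lin f)"
proof
  fix c d
  show "lin f (c + d) = lin f c + lin f d"
    unfolding lin_def using assms
    by (intro setsum_keys_plus_distrib) (auto simp: additive.zero additive.add)
qed

lemma lin_single:
  fixes f :: "'a \<Rightarrow> 'b::ab_group_add \<Rightarrow> 'c::ab_group_add"
  assumes "\<And>k. additive (f k)"
  shows "lin f (single k s) = f k s"
  using assms by (simp add: lin_def additive.zero)

text \<open>The tool for all operator identities below: they are checked on one basis element. The
  set \<open>A\<close> allows the check to assume, for instance, that the index set \<open>L\<close>
  of a cell is finite.\<close>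

lemma additive_eqI:
  fixes f g :: "('a \<Rightarrow>\<^sub>0 'b::ab_group_add) \<Rightarrow> 'c::ab_group_add"
  assumes f: "additive f" and g: "additive g" and c: "c \<in> supported_on A"
    and eq: "\<And>k s. k \<in> A \<Longrightarrow> f (single k s) = g (single k s)"
  shows "f c = g c"
proof -
  have "f (\<Sum>k\<in>keys c. single k (lookup c k)) = g (\<Sum>k\<in>keys c. single k (lookup c k))"
    unfolding additive.sum[OF f] additive.sum[OF g]
    using c by (intro sum.cong) (auto simp: supported_on_def eq)
  then show ?thesis
    by (simp flip: poly_mapping_sum_single)
qed

lemma additive_supported_on:
  fixes f :: "('a \<Rightarrow>\<^sub>0 'b::ab_group_add) \<Rightarrow> ('c \<Rightarrow>\<^sub>0 'd::ab_group_add)"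
  assumes f: "additive f" and c: "c \<in> supported_on A"
    and "\<And>k s. k \<in> A \<Longrightarrow> f (single k s) \<in> supported_on B"
  shows "f c \<in> supported_on B"
proof -
  have "f (\<Sum>k\<in>keys c. single k (lookup c k)) \<in> supported_on B"
    unfolding additive.sum[OF f]
    using c by (intro supported_on_sum assms) (auto simp: supported_on_def)
  then show ?thesis
    by (simp flip: poly_mapping_sum_single)
qed

lemma additive_comp: "additive f \<Longrightarrow> additive g \<Longrightarrow> additive (\<lambda>x. f (g x))"
  by (simp add: additive_def)

lemma additive_plus: "additive f \<Longrightarrow> additive g \<Longrightarrow> additive (\<lambda>x. f x + g x)"
  by (simp add: additive_def)

lemma additive_minus: "additive f \<Longrightarrow> additive g \<Longrightarrow> additive (\<lambda>x. f x - g x)"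
  by (simp add: additive_def)

lemma additive_sum: "(\<And>i. i \<in> S \<Longrightarrow> additive (f i)) \<Longrightarrow> additive (\<lambda>x. \<Sum>i\<in>S. f i x)"
  by (simp add: additive_def sum.distrib)

lemma additive_id: "additive (\<lambda>x. x)"
  by (simp add: additive_def)

lemma additive_zero: "additive (\<lambda>x. 0)"
  by (simp add: additive_def)

lemma additive_single: "additive (\<lambda>s. single k (u * s))" "additive (single k)"
  for u :: "'b::ring"
  by (simp_all add: additive_def distrib_left single_add)

text \<open>The projection onto the span of the basis elements in \<open>A\<close>. It splits off
  the part of a chain lying in a monomial ideal, and the part of one homological degree.\<close>

definition restr :: "'a set \<Rightarrow> ('a \<Rightarrow>\<^sub>0 'b) \<Rightarrow> ('a \<Rightarrow>\<^sub>0 'b::ab_group_add)" where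
  "restr A = lin (\<lambda>k s. if k \<in> A then single k s else 0)"

lemma additive_restr_aux: "additive (\<lambda>s. if k \<in> A then single k s else (0 :: 'a \<Rightarrow>\<^sub>0 'b::ab_group_add))"
  by (simp add: additive_def single_add)

lemma additive_restr: "additive (restr A)"
  unfolding restr_def by (intro additive_lin additive_restr_aux)

lemma restr_single [simp]: "restr A (single k s) = (if k \<in> A then single k s else 0)"
  unfolding restr_def by (subst lin_single) (auto intro: additive_restr_aux)

lemma lookup_restr: "lookup (restr A c) k = (if k \<in> A then lookup c k else 0)"
proof -
  have "lookup (\<Sum>k\<in>keys c. if k \<in> A then single k (lookup c k) else 0) x
      = (\<Sum>k\<in>keys c. if k = x then (if k \<in> A then lookup c k else 0) else 0)" for x
    unfolding lookup_sum by (intro sum.cong) (auto simp: lookup_single when_def)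
  then show ?thesis
    by (simp add: restr_def lin_def sum.delta in_keys_iff)
qed

lemma restr_supported_on: "c \<in> supported_on B \<Longrightarrow> restr A c \<in> supported_on (A \<inter> B)"
  by (auto simp: supported_on_iff lookup_restr)

lemma restr_id: "c \<in> supported_on A \<Longrightarrow> restr A c = c"
  by (intro poly_mapping_eqI) (auto simp: supported_on_iff lookup_restr)

section \<open>The Koszul complex of the polynomial ring\<close>

definition evar :: "'v \<Rightarrow> ('v \<Rightarrow>\<^sub>0 nat)" where
  "evar i = single i 1"

lemma lookup_evar: "lookup (evar i) j = (if j = i then 1 else 0)"
  by (auto simp: evar_def lookup_single)

lemma keys_evar [simp]: "keys (evar i) = {i}"
  by (simp add: evar_def)

lemma keys_add_exponents: "keys (a + b) = keys a \<union> keys b" for a b :: "'v \<Rightarrow>\<^sub>0 nat"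
  by (auto simp: in_keys_iff lookup_add)

text \<open>Subtraction of exponents is truncated: \<open>a - evar i\<close> is division by
  \<open>x_i\<close> if \<open>i\<close> is in the support of \<open>a\<close>, and \<open>a\<close>
  itself otherwise. The vertex \<open>i\<close> survives in the support when its exponent exceeds
  1.\<close>

lemma keys_minus_evar: "keys a - {i} \<subseteq> keys (a - evar i)" "keys (a - evar i) \<subseteq> keys a"
  by (auto simp: in_keys_iff lookup_minus lookup_evar split: if_splits)

lemma exponent_minus_plus: "i \<in> keys a \<Longrightarrow> a - evar i + evar i = a"
  by (rule poly_mapping_eqI) (auto simp: in_keys_iff lookup_minus lookup_add lookup_evar)

lemma exponent_plus_minus: "i \<in> keys a \<Longrightarrow> a + b - evar i = a - evar i + b"
  by (rule poly_mapping_eqI) (auto simp: in_keys_iff lookup_minus lookup_add lookup_evar)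

lemma keys_sum_evar: "finite F \<Longrightarrow> keys (\<Sum>i\<in>F. evar i) = F"
  by (auto simp: in_keys_iff lookup_sum lookup_evar split: if_splits)

lemma exponent_diff_add:
  "finite F \<Longrightarrow> F \<subseteq> keys a \<Longrightarrow> a - (\<Sum>i\<in>F. evar i) + (\<Sum>i\<in>F. evar i) = a"
  by (rule poly_mapping_eqI)
    (auto simp: lookup_add lookup_minus lookup_sum lookup_evar in_keys_iff subset_iff Suc_le_eq)

text \<open>The cell \<open>(a, L)\<close> stands for the basis element \<open>x\<^sup>a e\<^sub>L\<close> of the Koszul complex of the polynomial ring.\<close>

type_synonym 'v cell = "('v \<Rightarrow>\<^sub>0 nat) \<times> 'v set"

definition cells :: "'v set \<Rightarrow> 'v cell set" where
  "cells V = {(a, L). keys a \<union> L \<subseteq> V}"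

text \<open>The sign of moving \<open>e_i\<close> to its place in \<open>e_L\<close>. It makes sense
  whether or not \<open>i\<close> lies in \<open>L\<close>, so one sign serves both for removing
  \<open>i\<close> from \<open>L\<close> and for wedging \<open>e_i\<close> with
  \<open>e_L\<close>.\<close>

definition koszul_sign :: "'v::linorder \<Rightarrow> 'v set \<Rightarrow> 'k::comm_ring_1" where
  "koszul_sign i L = (- 1) ^ card {j\<in>L. j < i}"

lemma koszul_sign_square [simp]: "koszul_sign i L * (koszul_sign i L * s) = s"
  by (simp add: koszul_sign_def flip: mult.assoc power_add)

lemma koszul_sign_insert [simp]: "koszul_sign i (insert i L) = koszul_sign i L"
  by (auto simp: koszul_sign_def intro!: arg_cong[where f = "\<lambda>S. (-1) ^ card S"])

text \<open>Removing the smaller of two indices changes the position of the larger one by one, while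
  removing the larger leaves that of the smaller; hence the two orders of removal have opposite
  signs.\<close>

lemma koszul_sign_swap:
  assumes "finite L" "i \<in> L" "j \<in> L" "i \<noteq> j"
  shows "koszul_sign j (L - {i}) * koszul_sign i L
    + koszul_sign i (L - {j}) * koszul_sign j L = (0 :: 'k::comm_ring_1)"
proof -
  have *: "koszul_sign j (L - {i}) * koszul_sign i L
      + koszul_sign i (L - {j}) * koszul_sign j L = (0 :: 'k)"
    if "i < j" "i \<in> L" for i j
  proof -
    have "{k\<in>L. k < j} = insert i {k\<in>L - {i}. k < j}" "{k\<in>L - {j}. k < i} = {k\<in>L. k < i}"
      using that by auto
    then have "koszul_sign j L = - (koszul_sign j (L - {i}) :: 'k)"
      "koszul_sign i (L - {j}) = (koszul_sign i L :: 'k)"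
      using assms(1) by (simp_all add: koszul_sign_def)
    then show ?thesis
      by (simp add: mult.commute)
  qed
  show ?thesis
    using *[of i j] *[of j i] assms by (cases i j rule: linorder_cases) (auto simp: add.commute)
qed

text \<open>The terms cancel in pairs. The argument that the sum equals its own negative would not
  do, since 2 may vanish in the coefficient ring.\<close>

lemma sum_off_diagonal_antisym:
  fixes t :: "'a \<Rightarrow> 'a \<Rightarrow> 'b::ab_group_add"
  assumes "finite L" "\<And>i j. i \<in> L \<Longrightarrow> j \<in> L \<Longrightarrow> i \<noteq> j \<Longrightarrow> t i j + t j i = 0"
  shows "(\<Sum>i\<in>L. \<Sum>j\<in>L - {i}. t i j) = 0"
  using assms
proof (induction L)
  case (insert x L)
  have "(\<Sum>j\<in>insert x L - {i}. t i j) = t i x + (\<Sum>j\<in>L - {i}. t i j)" if "i \<in> L" for i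
  proof -
    have "insert x L - {i} = insert x (L - {i})"
      using that insert.hyps by auto
    then show ?thesis
      using insert.hyps by simp
  qed
  then have "(\<Sum>i\<in>insert x L. \<Sum>j\<in>insert x L - {i}. t i j)
      = (\<Sum>j\<in>L. t x j) + (\<Sum>i\<in>L. t i x) + (\<Sum>i\<in>L. \<Sum>j\<in>L - {i}. t i j)"
    using insert.hyps by (simp add: sum.distrib)
  also have "\<dots> = (\<Sum>i\<in>L. t x i + t i x)"
    using insert by (simp add: sum.distrib)
  also have "\<dots> = 0"
    using insert.hyps insert.prems by (intro sum.neutral) auto
  finally show ?case .
qed simp

definition cell_diff :: "('v::linorder cell \<Rightarrow>\<^sub>0 'k::comm_ring_1) \<Rightarrow> ('v cell \<Rightarrow>\<^sub>0 'k)" where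
  "cell_diff = lin (\<lambda>(a, L) s. \<Sum>i\<in>L. single (a + evar i, L - {i}) (koszul_sign i L * s))"

lemma additive_cell_diff_aux:
  "additive (\<lambda>s :: 'k::comm_ring_1. \<Sum>i\<in>L. single (a + evar i, L - {i}) (koszul_sign i L * s))"
  by (intro additive_sum additive_single)

lemma additive_cell_diff: "additive cell_diff"
  unfolding cell_diff_def by (intro additive_lin) (auto intro: additive_cell_diff_aux)

lemmas cell_diff_add = additive.add[OF additive_cell_diff]
lemmas cell_diff_diff = additive.diff[OF additive_cell_diff]
lemmas cell_diff_zero = additive.zero[OF additive_cell_diff]
lemmas cell_diff_sum = additive.sum[OF additive_cell_diff]

lemma cell_diff_single:
  "cell_diff (single (a, L) s) = (\<Sum>i\<in>L. single (a + evar i, L - {i}) (koszul_sign i L * s))"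
  unfolding cell_diff_def by (subst lin_single) (auto intro: additive_cell_diff_aux)

lemma cell_diff_supported_on_cells:
  fixes c :: "'v::linorder cell \<Rightarrow>\<^sub>0 'k::comm_ring_1"
  assumes "c \<in> supported_on (cells V)"
  shows "cell_diff c \<in> supported_on (cells V)"
proof (rule additive_supported_on[OF additive_cell_diff assms])
  fix k :: "'v cell" and s :: 'k
  obtain a L where k: "k = (a, L)"
    by (cases k)
  assume "k \<in> cells V"
  then show "cell_diff (single k s) \<in> supported_on (cells V)"
    unfolding k cell_diff_single
    by (intro supported_on_sum supported_on_single) (auto simp: cells_def keys_add_exponents)
qed

lemma cell_diff_cell_diff:
  fixes c :: "'v::linorder cell \<Rightarrow>\<^sub>0 'k::comm_ring_1"
  assumes c: "c \<in> supported_on (cells V)" and V: "finite V"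
  shows "cell_diff (cell_diff c) = 0"
proof (rule additive_eqI[OF additive_comp[OF additive_cell_diff additive_cell_diff] additive_zero c])
  fix k :: "'v cell" and s :: 'k
  obtain a L where k: "k = (a, L)"
    by (cases k)
  assume "k \<in> cells V"
  then have "finite L"
    using V by (auto simp: k cells_def finite_subset)
  define t where "t i j = single (a + evar i + evar j, L - {i} - {j})
    (koszul_sign j (L - {i}) * (koszul_sign i L * s))" for i j
  have "cell_diff (cell_diff (single k s)) = (\<Sum>i\<in>L. \<Sum>j\<in>L - {i}. t i j)"
    unfolding k cell_diff_single cell_diff_sum t_def ..
  also have "\<dots> = 0"
  proof (rule sum_off_diagonal_antisym[OF \<open>finite L\<close>])
    fix i j assume ij: "i \<in> L" "j \<in> L" "i \<noteq> j"
    have "L - {i} - {j} = L - {j} - {i}" "a + evar i + evar j = a + evar j + evar i"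
      by (auto simp: ac_simps)
    then have "t i j + t j i = single (a + evar i + evar j, L - {i} - {j})
      ((koszul_sign j (L - {i}) * koszul_sign i L + koszul_sign i (L - {j}) * koszul_sign j L) * s)"
      by (simp add: t_def distrib_right single_add mult.assoc)
    then show "t i j + t j i = 0"
      using koszul_sign_swap[OF \<open>finite L\<close> ij, where ?'k = 'k] by simp
  qed
  finally show "cell_diff (cell_diff (single k s)) = 0" .
qed

section \<open>Acyclicity\<close>

text \<open>The contracting homotopy \<open>x\<^sup>a e\<^sub>L \<mapsto> (x\<^sup>a / x\<^sub>m) e\<^sub>m \<and> e\<^sub>L\<close>, where \<open>m\<close> is the least vertex of the
  multidegree of the cell. No division by the degree occurs, so it works in every characteristic.\<close>

definition cell_homotopy :: "('v::linorder cell \<Rightarrow>\<^sub>0 'k::comm_ring_1) \<Rightarrow> ('v cell \<Rightarrow>\<^sub>0 'k)" where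
  "cell_homotopy = lin (\<lambda>(a, L) s.
     let m = Min (keys a \<union> L) in
     if keys a \<union> L = {} \<or> m \<in> L then 0 else single (a - evar m, insert m L) s)"

lemma additive_cell_homotopy_aux:
  "additive (\<lambda>s. let m = M in if P m then 0 else single (a - evar m, insert m L) (s::'k::comm_ring_1))"
  by (simp add: additive_def single_add)

lemma additive_cell_homotopy: "additive cell_homotopy"
  unfolding cell_homotopy_def by (intro additive_lin) (auto intro: additive_cell_homotopy_aux)

lemma cell_homotopy_single:
  "cell_homotopy (single (a, L) s) = (let m = Min (keys a \<union> L) in
     if keys a \<union> L = {} \<or> m \<in> L then 0 else single (a - evar m, insert m L) s)"
  unfolding cell_homotopy_def by (subst lin_single) (auto intro: additive_cell_homotopy_aux)

lemma cell_homotopy_supported_on_cells: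
  fixes c :: "'v::linorder cell \<Rightarrow>\<^sub>0 'k::comm_ring_1"
  assumes "c \<in> supported_on (cells V)" "finite V"
  shows "cell_homotopy c \<in> supported_on (cells V)"
proof (rule additive_supported_on[OF additive_cell_homotopy assms(1)])
  fix k :: "'v cell" and s :: 'k
  obtain a L where k: "k = (a, L)"
    by (cases k)
  assume "k \<in> cells V"
  then have *: "keys a \<union> L \<subseteq> V" "finite (keys a \<union> L)"
    using assms(2) finite_subset by (auto simp: k cells_def)
  show "cell_homotopy (single k s) \<in> supported_on (cells V)"
    unfolding k cell_homotopy_single Let_def
    using * keys_minus_evar(2)[of a] Min_in[OF *(2)] by (auto simp: cells_def intro!: supported_on_single)
qed

text \<open>The complex of the polynomial ring is exact except for the constants in homological
  degree 0; the cell \<open>(0, {})\<close> is the only one of multidegree zero, where no least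
  vertex exists.\<close>

lemma cell_homotopy_formula:
  fixes c :: "'v::linorder cell \<Rightarrow>\<^sub>0 'k::comm_ring_1"
  assumes c: "c \<in> supported_on (cells V)" and V: "finite V"
  shows "cell_diff (cell_homotopy c) + cell_homotopy (cell_diff c) = c - restr {(0, {})} c"
proof (rule additive_eqI[where f = "\<lambda>c. cell_diff (cell_homotopy c) + cell_homotopy (cell_diff c)"
      and g = "\<lambda>c. c - restr {(0, {})} c", OF _ _ c])
  show "additive (\<lambda>c :: 'v cell \<Rightarrow>\<^sub>0 'k. cell_diff (cell_homotopy c) + cell_homotopy (cell_diff c))"
    by (rule additive_plus[OF additive_comp[OF additive_cell_diff additive_cell_homotopy]
          additive_comp[OF additive_cell_homotopy additive_cell_diff]])
  show "additive (\<lambda>c :: 'v cell \<Rightarrow>\<^sub>0 'k. c - restr {(0, {})} c)"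
    by (rule additive_minus[OF additive_id additive_restr])
next
  fix k :: "'v cell" and s :: 'k
  obtain a L where k: "k = (a, L)"
    by (cases k)
  assume "k \<in> cells V"
  then have fin: "finite L"
    using V by (auto simp: k cells_def finite_subset)
  let ?S = "keys a \<union> L"
  let ?D = "cell_diff :: ('v cell \<Rightarrow>\<^sub>0 'k) \<Rightarrow> _"
  show "cell_diff (cell_homotopy (single k s)) + cell_homotopy (cell_diff (single k s))
    = single k s - restr {(0, {})} (single k s)"
  proof (cases "?S = {}")
    case True
    then have "k = (0, {})"
      by (auto simp: k in_keys_iff intro!: poly_mapping_eqI)
    then show ?thesis
      by (simp add: cell_homotopy_single cell_diff_single cell_diff_zero
          additive.zero[OF additive_cell_homotopy])
  next
    case ne: False
    define m where "m = Min ?S"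
    have m: "m \<in> ?S" "\<And>x. x \<in> ?S \<Longrightarrow> m \<le> x"
      using fin ne Min_in[of ?S] by (auto simp: m_def)
    \<comment> \<open>Every term of the differential has the same set of vertices in its
      multidegree, so the homotopy uses the same \<open>m\<close> on all of them.\<close>
    have keys_eq: "keys (a + evar i) \<union> (L - {i}) = ?S" if "i \<in> L" for i
      using that by (auto simp: keys_add_exponents)
    have sign_m: "koszul_sign m L = (1::'k)"
    proof -
      have none: "{j \<in> L. j < m} = {}"
        using m(2) by force
      show ?thesis
        unfolding koszul_sign_def none by simp
    qed
    have "(0, {}) \<noteq> (a, L)"
      using ne by auto
    then have rhs: "single k s - restr {(0, {})} (single k s) = single (a, L) s"
      by (auto simp: k)
    have hd: "cell_homotopy (?D (single (a, L) s)) = (\<Sum>i\<in>L. if m \<in> L - {i} then 0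
        else single (a + evar i - evar m, insert m (L - {i})) (koszul_sign i L * s))"
      unfolding cell_diff_single additive.sum[OF additive_cell_homotopy]
      by (intro sum.cong refl) (simp only: cell_homotopy_single keys_eq ne m_def Let_def, simp)
    show ?thesis
    proof (cases "m \<in> L")
      case True
      \<comment> \<open>The homotopy kills the cell itself and all terms of its differential that
        still contain \<open>m\<close>. Only the removal of \<open>m\<close> counts; it has sign 1
        as \<open>m\<close> is least, and the homotopy undoes it.\<close>
      have "cell_homotopy (?D (single (a, L) s)) = (\<Sum>i\<in>L. if i = m then single (a, L) s else 0)"
        unfolding hd using True by (intro sum.cong refl) (auto simp: sign_m insert_absorb)
      also have "\<dots> = single (a, L) s"
        using True fin by (simp add: sum.delta)
      finally show ?thesis
        using True ne unfolding rhs by (simp add: k cell_homotopy_single m_def[symmetric] cell_diff_zero)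
    next
      case False
      then have ma: "m \<in> keys a"
        using m by auto
      \<comment> \<open>Inserting the least index \<open>m\<close> moves every \<open>i\<close> in
        \<open>L\<close> by one position. So the two composites cancel on these terms, and what
        remains is the removal of the inserted \<open>m\<close>, which returns the cell.\<close>
      have sgn: "koszul_sign i (insert m L) = - (koszul_sign i L :: 'k)" if "i \<in> L" for i
      proof -
        have "m < i"
          using m(2)[of i] that False by (cases "i = m") auto
        then have "{j \<in> insert m L. j < i} = insert m {j \<in> L. j < i}"
          by auto
        then show ?thesis
          using fin False by (simp add: koszul_sign_def)
      qed
      have "cell_homotopy (?D (single (a, L) s)) = (\<Sum>i\<in>L.
        single (a + evar i - evar m, insert m (L - {i})) (koszul_sign i L * s))"
        unfolding hd using False by (intro sum.cong refl) auto
      moreover have "?D (cell_homotopy (single (a, L) s)) = single (a, L) s - (\<Sum>i\<in>L.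
        single (a + evar i - evar m, insert m (L - {i})) (koszul_sign i L * s))"
      proof -
        have "?D (cell_homotopy (single (a, L) s)) = ?D (single (a - evar m, insert m L) s)"
          using False ne by (auto simp: cell_homotopy_single m_def[symmetric])
        also have "\<dots> = single (a, L) s + (\<Sum>i\<in>L. single (a - evar m + evar i, insert m L - {i})
            (koszul_sign i (insert m L) * s))"
          using fin False exponent_minus_plus[OF ma] by (simp add: cell_diff_single sign_m)
        also have "(\<Sum>i\<in>L. single (a - evar m + evar i, insert m L - {i}) (koszul_sign i (insert m L) * s))
          = (\<Sum>i\<in>L. - single (a + evar i - evar m, insert m (L - {i})) (koszul_sign i L * s))"
        proof (intro sum.cong refl)
          fix i assume i: "i \<in> L"
          then have "insert m L - {i} = insert m (L - {i})"
            using False by auto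
          then show "single (a - evar m + evar i, insert m L - {i}) (koszul_sign i (insert m L) * s)
            = - single (a + evar i - evar m, insert m (L - {i})) (koszul_sign i L * s)"
            by (simp only: sgn[OF i] exponent_plus_minus[OF ma] single_uminus[symmetric] mult_minus_left)
        qed
        finally show ?thesis
          by (simp add: sum_negf)
      qed
      ultimately show ?thesis
        unfolding rhs by (simp add: k)
    qed
  qed
qed

section \<open>Families of sets with leaves\<close>

text \<open>The leaf condition on bare families of sets, without faces or maximality: it has to make
  sense for the sets \<open>H - F\<close>, which may be nested.\<close>

definition leafy :: "'v set set \<Rightarrow> bool" where
  "leafy \<F> \<longleftrightarrow> (\<forall>S. S \<subseteq> \<F> \<and> S \<noteq> {} \<longrightarrow>
     (\<exists>F\<in>S. S = {F} \<or> (\<exists>G\<in>S - {F}. \<forall>H\<in>S - {F}. F \<inter> H \<subseteq> G)))"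

lemma leafy_subset: "leafy \<F> \<Longrightarrow> \<G> \<subseteq> \<F> \<Longrightarrow> leafy \<G>"
  unfolding leafy_def by blast

text \<open>A leaf of a subfamily of \<open>\<F>\<close> remains a leaf after deleting
  \<open>W\<close>, with the trace of the same \<open>G\<close>, because
  \<open>F \<inter> H \<subseteq> G\<close> is preserved.\<close>

lemma leafy_trace:
  assumes "leafy \<F>"
  shows "leafy ((\<lambda>H. H - W) ` \<F>)"
  unfolding leafy_def
proof (intro allI impI; elim conjE)
  fix S assume S: "S \<subseteq> (\<lambda>H. H - W) ` \<F>" "S \<noteq> {}"
  \<comment> \<open>One preimage is chosen for each member of \<open>S\<close>. Injectivity on
    \<open>T\<close> keeps the trace of \<open>G\<close> different from that of
    \<open>F\<close>.\<close>
  obtain T where T: "T \<subseteq> \<F>" "inj_on (\<lambda>H. H - W) T" "S = (\<lambda>H. H - W) ` T"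
    using S(1) by (meson subset_image_inj)
  then have "T \<noteq> {}"
    using S(2) by auto
  then obtain F where F: "F \<in> T" "T = {F} \<or> (\<exists>G\<in>T - {F}. \<forall>H\<in>T - {F}. F \<inter> H \<subseteq> G)"
    using assms T(1) unfolding leafy_def by meson
  show "\<exists>F\<in>S. S = {F} \<or> (\<exists>G\<in>S - {F}. \<forall>H\<in>S - {F}. F \<inter> H \<subseteq> G)"
  proof (rule bexI[of _ "F - W"])
    show "F - W \<in> S"
      using F T by auto
    show "S = {F - W} \<or> (\<exists>G\<in>S - {F - W}. \<forall>H\<in>S - {F - W}. (F - W) \<inter> H \<subseteq> G)"
      using F(2)
    proof
      assume "\<exists>G\<in>T - {F}. \<forall>H\<in>T - {F}. F \<inter> H \<subseteq> G"
      then obtain G where G: "G \<in> T - {F}" "\<forall>H\<in>T - {F}. F \<inter> H \<subseteq> G"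
        by blast
      have "G - W \<noteq> F - W"
        using inj_onD[OF T(2), of G F] G(1) F(1) by blast
      then have "G - W \<in> S - {F - W}"
        using G(1) T(3) by simp
      moreover have "\<forall>H\<in>S - {F - W}. (F - W) \<inter> H \<subseteq> G - W"
        using G(2) T(3) by blast
      ultimately show ?thesis
        by blast
    qed (simp add: T)
  qed
qed

text \<open>If \<open>G\<close> contains all intersections of the leaf \<open>F\<close> with other
  members, any vertex of \<open>F - G\<close> is free, and the antichain condition provides
  one.\<close>

lemma leafy_obtain_free_vertex:
  assumes "leafy \<F>" "\<F> \<noteq> {}" "{} \<notin> \<F>" and antichain: "\<And>A B. A \<in> \<F> \<Longrightarrow> B \<in> \<F> \<Longrightarrow> A \<subseteq> B \<Longrightarrow> A = B"
  obtains F i where "F \<in> \<F>" "i \<in> F" "\<And>H. H \<in> \<F> - {F} \<Longrightarrow> i \<notin> H"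
proof -
  have "\<exists>F\<in>\<F>. \<F> = {F} \<or> (\<exists>G\<in>\<F> - {F}. \<forall>H\<in>\<F> - {F}. F \<inter> H \<subseteq> G)"
    by (rule assms(1)[unfolded leafy_def, THEN spec, THEN mp]) (use assms(2) in simp)
  then obtain F where F: "F \<in> \<F>" "\<F> = {F} \<or> (\<exists>G\<in>\<F> - {F}. \<forall>H\<in>\<F> - {F}. F \<inter> H \<subseteq> G)"
    by (elim bexE) (rule that)
  show ?thesis
  proof (cases "\<F> = {F}")
    case True
    obtain i where "i \<in> F"
      using F(1) assms(3) by (metis ex_in_conv)
    then show ?thesis
      using that[of F i] F(1) True by blast
  next
    case False
    then obtain G where G: "G \<in> \<F> - {F}" "\<forall>H\<in>\<F> - {F}. F \<inter> H \<subseteq> G"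
      using F(2) by blast
    then obtain i where "i \<in> F" "i \<notin> G"
      using antichain[of F G] F(1) by blast
    then show ?thesis
      using that[of F i] F(1) G(2) by blast
  qed
qed

section \<open>Monomial cycles span\<close>

text \<open>The basis elements with coefficient in the ideal generated by the \<open>x_H\<close>;
  supports decide, as the generators are squarefree.\<close>

definition ideal_cells :: "'v set set \<Rightarrow> 'v cell set" where
  "ideal_cells \<F> = {(a, L). \<exists>H\<in>\<F>. H \<subseteq> keys a}"

text \<open>The monomial cycles modulo that ideal: the terms of the differential of
  \<open>x^a e_L\<close> belong to distinct \<open>e_{L - {i}}\<close> and cannot cancel, so each
  \<open>x_i x^a\<close> has to be in the ideal by itself.\<close>

definition cycle_cells :: "'v set set \<Rightarrow> 'v cell set" where
  "cycle_cells \<F> = {(a, L). \<forall>i\<in>L. \<exists>H\<in>\<F>. H \<subseteq> keys (a + evar i)}"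

lemma ideal_cells_mono: "\<G> \<subseteq> \<F> \<Longrightarrow> ideal_cells \<G> \<subseteq> ideal_cells \<F>"
  unfolding ideal_cells_def by blast

lemma cycle_cells_mono: "\<G> \<subseteq> \<F> \<Longrightarrow> cycle_cells \<G> \<subseteq> cycle_cells \<F>"
  unfolding cycle_cells_def by blast

definition shift :: "('v \<Rightarrow>\<^sub>0 nat) \<Rightarrow> ('v cell \<Rightarrow>\<^sub>0 'k::comm_ring_1) \<Rightarrow> ('v cell \<Rightarrow>\<^sub>0 'k)" where
  "shift u = lin (\<lambda>(a, L). single (a + u, L))"

lemma additive_shift: "additive (shift u)"
  unfolding shift_def by (intro additive_lin) (auto intro: additive_single)

lemma shift_single [simp]: "shift u (single (a, L) s) = single (a + u, L) s"
  unfolding shift_def by (subst lin_single) (auto intro: additive_single)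

text \<open>Multiplication by a monomial is injective on cells, so a condition on the product can be
  read back as one on the factor.\<close>

lemma lookup_shift: "lookup (shift u c) (a + u, L) = lookup c (a, L)"
proof -
  have "lookup (\<Sum>k\<in>keys c. case k of (b, M) \<Rightarrow> single (b + u, M) (lookup c k)) (a + u, L)
      = (\<Sum>k\<in>keys c. if k = (a, L) then lookup c (a, L) else 0)"
    unfolding lookup_sum by (intro sum.cong) (auto simp: lookup_single when_def split: if_splits)
  then show ?thesis
    by (simp add: shift_def lin_def sum.delta in_keys_iff split_beta)
qed

lemma cell_diff_shift:
  fixes c :: "'v::linorder cell \<Rightarrow>\<^sub>0 'k::comm_ring_1"
  shows "cell_diff (shift u c) = shift u (cell_diff c)"
proof (rule additive_eqI[OF additive_comp[OF additive_cell_diff additive_shift]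
      additive_comp[OF additive_shift additive_cell_diff]])
  show "c \<in> supported_on UNIV"
    by (simp add: supported_on_def)
  fix k :: "'v cell" and s :: 'k
  obtain a L where k: "k = (a, L)"
    by (cases k)
  show "cell_diff (shift u (single k s)) = shift u (cell_diff (single k s))"
    by (simp add: k cell_diff_single additive.sum[OF additive_shift] ac_simps)
qed

lemma cell_diff_supported_on_ideal_cells:
  fixes c :: "'v::linorder cell \<Rightarrow>\<^sub>0 'k::comm_ring_1"
  assumes "c \<in> supported_on (ideal_cells \<F>)"
  shows "cell_diff c \<in> supported_on (ideal_cells \<F>)"
proof (rule additive_supported_on[OF additive_cell_diff assms])
  fix k :: "'v cell" and s :: 'k
  obtain a L where k: "k = (a, L)"
    by (cases k)
  assume "k \<in> ideal_cells \<F>"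
  then show "cell_diff (single k s) \<in> supported_on (ideal_cells \<F>)"
    unfolding k cell_diff_single
    by (intro supported_on_sum supported_on_single) (auto simp: ideal_cells_def keys_add_exponents)
qed

text \<open>The map sending \<open>m\<close> to \<open>x^u e_i \<and> m\<close>; it is applied with
  \<open>x_F / x_i\<close> in place of \<open>x^u\<close>.\<close>

definition wedge_lift ::
  "('v \<Rightarrow>\<^sub>0 nat) \<Rightarrow> 'v \<Rightarrow> ('v::linorder cell \<Rightarrow>\<^sub>0 'k::comm_ring_1) \<Rightarrow> ('v cell \<Rightarrow>\<^sub>0 'k)" where
  "wedge_lift u i = lin (\<lambda>(a, L) s.
     if i \<in> L then 0 else single (a + u, insert i L) (koszul_sign i L * s))"

lemma additive_wedge_lift_aux: "additive (\<lambda>s. if P then 0 else single k (t * s :: 'k::comm_ring_1))"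
  by (simp add: additive_def single_add distrib_left)

lemma additive_wedge_lift: "additive (wedge_lift u i)"
  unfolding wedge_lift_def by (intro additive_lin) (auto intro: additive_wedge_lift_aux)

lemma wedge_lift_single: "wedge_lift u i (single (a, L) s) =
    (if i \<in> L then 0 else single (a + u, insert i L) (koszul_sign i L * s))"
  unfolding wedge_lift_def
  by (subst lin_single) (auto intro: additive_wedge_lift_aux)

text \<open>If \<open>i\<close> is a free vertex of \<open>F\<close> and \<open>f e\<^sub>L\<close> is a monomial cycle modulo the colon ideal
  \<open>J : x\<^sub>F\<close>, then \<open>(x\<^sub>F / x\<^sub>i) f e\<^sub>i e\<^sub>L\<close> is a monomial cycle modulo \<open>J + (x\<^sub>F)\<close> whose differential
  is \<open>x\<^sub>F f e\<^sub>L\<close> modulo \<open>J\<close>: since \<open>i\<close> occurs in no generator of \<open>J\<close>, all terms but the first are in \<open>J\<close>.\<close>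

context
  fixes \<F> :: "'v::linorder set set" and F :: "'v set" and i :: 'v and u :: "'v \<Rightarrow>\<^sub>0 nat"
  assumes i: "i \<in> F" and free: "\<And>H. H \<in> \<F> - {F} \<Longrightarrow> i \<notin> H" and u: "keys u = F"
begin

text \<open>The factor \<open>x_F / x_i\<close> supplies all vertices of \<open>F\<close> but
  \<open>i\<close>, and no other member \<open>H\<close> contains \<open>i\<close>; so divisibility
  by \<open>x_{H - F}\<close> becomes divisibility by \<open>x_H\<close>.\<close>

lemma wedge_lift_aux:
  assumes aL: "(a, L) \<in> cycle_cells ((\<lambda>H. H - F) ` (\<F> - {F}))" and l: "l \<in> L" and "i \<notin> L"
  shows "\<exists>H\<in>\<F> - {F}. H \<subseteq> keys (a + (u - evar i) + evar l)"
proof -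
  have "\<exists>H\<in>(\<lambda>H. H - F) ` (\<F> - {F}). H \<subseteq> keys (a + evar l)"
    using aL l by (simp add: cycle_cells_def)
  then obtain H where H: "H \<in> \<F> - {F}" "H - F \<subseteq> keys (a + evar l)"
    by blast
  have "H \<subseteq> keys (a + (u - evar i) + evar l)"
    using free[OF H(1)] H(2) keys_minus_evar(1)[of u i] by (auto simp: keys_add_exponents u)
  then show ?thesis
    using H(1) by blast
qed

lemma wedge_lift_cycle_cells:
  fixes c :: "'v cell \<Rightarrow>\<^sub>0 'k::comm_ring_1"
  assumes F: "F \<in> \<F>" "F \<subseteq> V"
    and c: "c \<in> supported_on (cells V \<inter> cycle_cells ((\<lambda>H. H - F) ` (\<F> - {F})))"
  shows "wedge_lift (u - evar i) i c \<in> supported_on (cells V \<inter> cycle_cells \<F>)"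
proof (rule additive_supported_on[OF additive_wedge_lift c])
  fix k :: "'v cell" and s :: 'k
  obtain a L where k: "k = (a, L)"
    by (cases k)
  assume *: "k \<in> cells V \<inter> cycle_cells ((\<lambda>H. H - F) ` (\<F> - {F}))"
  have "(a + (u - evar i), insert i L) \<in> cells V \<inter> cycle_cells \<F>" if "i \<notin> L"
  proof -
    have "keys (u - evar i) \<subseteq> F"
      using keys_minus_evar(2)[of u i] u by simp
    then have cell: "(a + (u - evar i), insert i L) \<in> cells V"
      using F(2) i * by (auto simp: k cells_def keys_add_exponents)
    \<comment> \<open>Removing \<open>e_i\<close> multiplies by \<open>x_i\<close>, which completes
      \<open>x_F\<close>: this term is in the ideal thanks to the generator of \<open>F\<close>
      itself, all others thanks to \<open>wedge_lift_aux\<close>.\<close>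
    have "F \<subseteq> keys (a + (u - evar i) + evar i)"
      using i u keys_minus_evar(1)[of u i] by (auto simp: keys_add_exponents)
    then have "\<exists>H\<in>\<F>. H \<subseteq> keys (a + (u - evar i) + evar i)"
      using F(1) by blast
    moreover have "\<exists>H\<in>\<F>. H \<subseteq> keys (a + (u - evar i) + evar l)" if "l \<in> L" for l
      using wedge_lift_aux[OF _ that \<open>i \<notin> L\<close>, of a] * by (auto simp: k)
    ultimately show ?thesis
      using cell by (simp add: cycle_cells_def)
  qed
  then show "wedge_lift (u - evar i) i (single k s) \<in> supported_on (cells V \<inter> cycle_cells \<F>)"
    by (auto simp: k wedge_lift_single)
qed

lemma cell_diff_wedge_lift:
  fixes c :: "'v cell \<Rightarrow>\<^sub>0 'k::comm_ring_1"
  assumes V: "finite V"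
    and c: "c \<in> supported_on (cells V \<inter> cycle_cells ((\<lambda>H. H - F) ` (\<F> - {F})))"
  shows "shift u c - cell_diff (wedge_lift (u - evar i) i c) \<in> supported_on (ideal_cells (\<F> - {F}))"
proof (rule additive_supported_on[where f = "\<lambda>c. shift u c - cell_diff (wedge_lift (u - evar i) i c)", OF _ c])
  show "additive (\<lambda>c :: 'v cell \<Rightarrow>\<^sub>0 'k. shift u c - cell_diff (wedge_lift (u - evar i) i c))"
    by (rule additive_minus[OF additive_shift additive_comp[OF additive_cell_diff additive_wedge_lift]])
  fix k :: "'v cell" and s :: 'k
  obtain a L where k: "k = (a, L)"
    by (cases k)
  let ?D = "cell_diff :: ('v cell \<Rightarrow>\<^sub>0 'k) \<Rightarrow> _"
  assume *: "k \<in> cells V \<inter> cycle_cells ((\<lambda>H. H - F) ` (\<F> - {F}))"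
  then have "finite L"
    using V by (auto simp: k cells_def finite_subset)
  show "shift u (single k s) - ?D (wedge_lift (u - evar i) i (single k s))
    \<in> supported_on (ideal_cells (\<F> - {F}))"
  proof (cases "i \<in> L")
    case True
    \<comment> \<open>Here the wedge product vanishes, so \<open>x_F x^a\<close> must already be in
      the smaller ideal. It is: the cycle condition at \<open>i\<close> puts \<open>x_i x^a\<close>
      in the colon ideal, and \<open>i\<close>, being in \<open>F\<close>, occurs in none of its
      generators.\<close>
    then have "\<exists>H\<in>(\<lambda>H. H - F) ` (\<F> - {F}). H \<subseteq> keys (a + evar i)"
      using * by (simp add: k cycle_cells_def)
    then obtain H where "H \<in> \<F> - {F}" "H - F \<subseteq> keys (a + evar i)"
      by blast
    then have "H \<in> \<F> - {F}" "H \<subseteq> keys (a + u)"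
      using free i u by (auto simp: keys_add_exponents)
    then have "(a + u, L) \<in> ideal_cells (\<F> - {F})"
      unfolding ideal_cells_def by blast
    then show ?thesis
      using True by (simp add: k wedge_lift_single cell_diff_zero)
  next
    case False
    \<comment> \<open>The term removing \<open>e_i\<close> from the wedge product is exactly the
      shifted cell, its sign occurring twice; only the terms for \<open>l\<close> in
      \<open>L\<close> remain.\<close>
    have "a + (u - evar i) + evar i = a + u"
      using exponent_minus_plus[of i u] i u by (simp add: add.assoc)
    then have "shift u (single k s) - ?D (wedge_lift (u - evar i) i (single k s)) =
        - (\<Sum>l\<in>L. single (a + (u - evar i) + evar l, insert i L - {l})
          (koszul_sign l (insert i L) * (koszul_sign i L * s)))"
      using False \<open>finite L\<close> by (simp add: k wedge_lift_single cell_diff_single)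
    moreover have "(a + (u - evar i) + evar l, insert i L - {l}) \<in> ideal_cells (\<F> - {F})" if "l \<in> L" for l
      using wedge_lift_aux[OF _ that False, of a] * by (simp add: k ideal_cells_def)
    ultimately show ?thesis
      by (simp add: supported_on_uminus supported_on_sum)
  qed
qed

end

text \<open>The chain is arbitrary in the induction since the hypothesis is used twice: modulo the
  colon ideal for the quotient by \<open>x_F\<close>, and modulo the smaller ideal for the corrected
  chain.\<close>

theorem monomial_cycles_span_cells:
  fixes \<F> :: "'v::linorder set set" and c :: "'v cell \<Rightarrow>\<^sub>0 'k::comm_ring_1"
  assumes V: "finite V" and "\<F> \<subseteq> Pow V" "leafy \<F>"
    and "c \<in> supported_on (cells V)" "cell_diff c \<in> supported_on (ideal_cells \<F>)"
  shows "\<exists>z b. z \<in> supported_on (cells V \<inter> cycle_cells \<F>) \<and> b \<in> supported_on (cells V) \<and>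
    c - z - cell_diff b \<in> supported_on (ideal_cells \<F>)"
  using assms(2-)
proof (induction "card \<F>" arbitrary: \<F> c rule: less_induct)
  case less
  let ?D = "cell_diff :: ('v cell \<Rightarrow>\<^sub>0 'k) \<Rightarrow> _"
  have fin: "finite \<F>" "\<And>H. H \<in> \<F> \<Longrightarrow> finite H"
    using V less.prems(1) finite_subset[of _ "Pow V"] finite_subset[of _ V] by auto
  consider (empty) "\<F> = {}" | (unit) "{} \<in> \<F>"
    | (redundant) A B where "A \<in> \<F>" "B \<in> \<F>" "A \<subset> B"
    | (antichain) "\<F> \<noteq> {}" "{} \<notin> \<F>" "\<And>A B. A \<in> \<F> \<Longrightarrow> B \<in> \<F> \<Longrightarrow> A \<subseteq> B \<Longrightarrow> A = B"
    by blast
  then show ?case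
  proof cases
    case empty
    \<comment> \<open>With no generators \<open>c\<close> is a genuine cycle, and the homotopy
      writes it as a boundary plus a constant; the constant is a monomial cycle vacuously, as its
      index set is empty.\<close>
    then have "?D c = 0"
      using less.prems(4) by (auto simp: ideal_cells_def supported_on_def)
    then have "c - restr {(0, {})} c - ?D (cell_homotopy c) = 0"
      using cell_homotopy_formula[OF less.prems(3) V]
      by (simp add: additive.zero[OF additive_cell_homotopy])
    moreover have "restr {(0, {})} c \<in> supported_on (cells V \<inter> cycle_cells \<F>)"
      by (auto simp: supported_on_iff lookup_restr cells_def cycle_cells_def)
    ultimately show ?thesis
      using cell_homotopy_supported_on_cells[OF less.prems(3) V] supported_on_zero by metis
  next
    case unit
    then have "ideal_cells \<F> = UNIV"
      by (auto simp: ideal_cells_def)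
    then show ?thesis
      by (intro exI[of _ 0]) (simp add: supported_on_def)
  next
    case (redundant A B)
    \<comment> \<open>The generator of the larger set \<open>B\<close> is a multiple of that of
      \<open>A\<close>; dropping it changes neither the ideal nor its monomial cycles.\<close>
    have card: "card (\<F> - {B}) < card \<F>"
      using fin(1) redundant(2) by (rule card_Diff1_less)
    have "(\<exists>H\<in>\<F>. H \<subseteq> T) \<longleftrightarrow> (\<exists>H\<in>\<F> - {B}. H \<subseteq> T)" for T
    proof -
      have "A \<in> \<F> - {B}" "B \<subseteq> T \<longrightarrow> A \<subseteq> T"
        using redundant by auto
      then show ?thesis
        by blast
    qed
    then have eq: "ideal_cells \<F> = ideal_cells (\<F> - {B})" "cycle_cells \<F> = cycle_cells (\<F> - {B})"
      by (simp_all add: ideal_cells_def cycle_cells_def)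
    show ?thesis
      unfolding eq
    proof (rule less.hyps[OF card _ _ less.prems(3)])
      show "leafy (\<F> - {B})"
        by (rule leafy_subset[OF less.prems(2)]) simp
    qed (use less.prems(1,4) eq(1) in auto)
  next
    case antichain
    obtain F i where F: "F \<in> \<F>" "i \<in> F" and free: "\<And>H. H \<in> \<F> - {F} \<Longrightarrow> i \<notin> H"
      by (rule leafy_obtain_free_vertex[OF less.prems(2) antichain(1,2)]) (use antichain(3) in blast)+
    \<comment> \<open>\<open>\<G>\<close> generates the ideal \<open>J\<close> of the other
      generators, and \<open>\<H>\<close> the colon ideal \<open>J : x_F\<close>. The image
      \<open>\<H>\<close> has at most as many members as \<open>\<G>\<close>, so both are smaller
      than \<open>\<F>\<close>.\<close>
    define \<G> where "\<G> = \<F> - {F}"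
    define \<H> where "\<H> = (\<lambda>H. H - F) ` \<G>"
    have card: "card \<G> < card \<F>" "card \<H> < card \<F>"
      using card_Diff1_less[OF fin(1) F(1)] card_image_le[of \<G> "\<lambda>H. H - F"] fin(1)
      by (auto simp: \<G>_def \<H>_def)
    define u where "u = (\<Sum>j\<in>F. evar j)"
    have u: "keys u = F"
      unfolding u_def by (rule keys_sum_evar[OF fin(2)[OF F(1)]])
    \<comment> \<open>The part of the differential in \<open>J\<close> is split off by support.
      Every remaining cell is divisible by \<open>x_F\<close>, so the truncated subtraction in
      \<open>b\<close> is an exact division.\<close>
    define y where "y = restr (ideal_cells \<G>) (?D c)"
    define b where "b = lin (\<lambda>(a, L). single (a - u, L)) (?D c - y)"
    have y: "y \<in> supported_on (ideal_cells \<G>)"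
      by (simp add: y_def supported_on_iff lookup_restr)
    have y': "?D c - y \<in> supported_on (cells V \<inter> (ideal_cells \<F> - ideal_cells \<G>))"
      using less.prems(4) cell_diff_supported_on_cells[OF less.prems(3)]
      by (auto simp: y_def supported_on_iff lookup_restr lookup_minus)
    have add_b: "additive (lin (\<lambda>(a, L). single (a - u, L)) :: ('v cell \<Rightarrow>\<^sub>0 'k) \<Rightarrow> _)"
      by (intro additive_lin) (auto intro: additive_single)
    have lin_b: "lin (\<lambda>(a, L). single (a - u, L)) (single (a, L) s) = single (a - u, L) (s::'k)"
      for a and L :: "'v set" and s
      by (subst lin_single) (auto intro: additive_single)
    have b_cells: "b \<in> supported_on (cells V)"
      unfolding b_def
    proof (rule additive_supported_on[OF add_b y'])
      fix k :: "'v cell" and s :: 'k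
      assume "k \<in> cells V \<inter> (ideal_cells \<F> - ideal_cells \<G>)"
      then show "lin (\<lambda>(a, L). single (a - u, L)) (single k s) \<in> supported_on (cells V)"
        by (cases k) (auto simp: lin_b cells_def in_keys_iff lookup_minus subset_iff
            intro!: supported_on_single)
    qed
    have shift_b: "shift u b = ?D c - y"
      unfolding b_def
    proof (rule additive_eqI[OF additive_comp[OF additive_shift add_b] additive_id y'])
      fix k :: "'v cell" and s :: 'k
      obtain a L where k: "k = (a, L)"
        by (cases k)
      assume "k \<in> cells V \<inter> (ideal_cells \<F> - ideal_cells \<G>)"
      then have "F \<subseteq> keys a"
        by (auto simp: k ideal_cells_def \<G>_def)
      then have "a - u + u = a"
        unfolding u_def by (rule exponent_diff_add[OF fin(2)[OF F(1)]])
      then show "shift u (lin (\<lambda>(a, L). single (a - u, L)) (single k s)) = single k s"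
        by (simp add: k lin_b)
    qed
    have "?D b \<in> supported_on (ideal_cells \<H>)"
    proof -
      \<comment> \<open>The differential of \<open>dc = y + x_F b\<close> is zero, so
        \<open>x_F db = - dy\<close> lies in \<open>J\<close>; cancelling \<open>x_F\<close> puts
        \<open>db\<close> in the colon ideal.\<close>
      have "shift u (?D b) = - ?D y"
        using cell_diff_cell_diff[OF less.prems(3) V]
        by (simp add: shift_b cell_diff_diff flip: cell_diff_shift)
      then have "shift u (?D b) \<in> supported_on (ideal_cells \<G>)"
        using cell_diff_supported_on_ideal_cells[OF y] by (simp add: supported_on_uminus)
      moreover have "(a, L) \<in> ideal_cells \<H>" if "(a + u, L) \<in> ideal_cells \<G>" for a L
        using that by (auto simp: ideal_cells_def \<H>_def keys_add_exponents u)
      ultimately have "lookup (shift u (?D b)) (a + u, L) = 0" if "(a, L) \<notin> ideal_cells \<H>" for a L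
        using that unfolding supported_on_iff by blast
      then show ?thesis
        by (auto simp: supported_on_iff lookup_shift)
    qed
    moreover have "\<H> \<subseteq> Pow V" "leafy \<H>"
      using less.prems(1) leafy_trace[OF leafy_subset[OF less.prems(2)], of \<G> F]
      by (auto simp: \<H>_def \<G>_def)
    ultimately have "\<exists>z b'. z \<in> supported_on (cells V \<inter> cycle_cells \<H>) \<and> b' \<in> supported_on (cells V) \<and>
        b - z - ?D b' \<in> supported_on (ideal_cells \<H>)"
      by (intro less.hyps[OF card(2) _ _ b_cells])
    then obtain z b' where z: "z \<in> supported_on (cells V \<inter> cycle_cells \<H>)"
      and b': "b' \<in> supported_on (cells V)" "b - z - ?D b' \<in> supported_on (ideal_cells \<H>)"
      by blast
    define w where "w = wedge_lift (u - evar i) i z"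
    \<comment> \<open>Subtracting \<open>x_F b'\<close> does not change \<open>c\<close> modulo
      \<open>I\<close>, but removes the boundary part of \<open>x_F b\<close> from the differential,
      as \<open>w\<close> removes the part coming from \<open>z\<close>. What is left of it lies in
      \<open>J\<close>.\<close>
    define c' where "c' = c - w - shift u b'"
    have "F \<subseteq> V"
      using F(1) less.prems(1) by auto
    have zQ: "z \<in> supported_on (cells V \<inter> cycle_cells ((\<lambda>H. H - F) ` (\<F> - {F})))"
      using z by (simp add: \<H>_def \<G>_def)
    have w: "w \<in> supported_on (cells V \<inter> cycle_cells \<F>)"
      unfolding w_def using wedge_lift_cycle_cells[OF F(2) free u F(1) \<open>F \<subseteq> V\<close> zQ] .
    have wz: "shift u z - ?D w \<in> supported_on (ideal_cells \<G>)"
      unfolding w_def \<G>_def using cell_diff_wedge_lift[OF F(2) free u V zQ] .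
    have shift_b': "shift u b' \<in> supported_on (cells V \<inter> ideal_cells \<F>)"
    proof (rule additive_supported_on[OF additive_shift b'(1)])
      fix k :: "'v cell" and s :: 'k
      assume "k \<in> cells V"
      then show "shift u (single k s) \<in> supported_on (cells V \<inter> ideal_cells \<F>)"
        using F(1) \<open>F \<subseteq> V\<close>
        by (cases k) (auto simp: cells_def ideal_cells_def keys_add_exponents u intro!: supported_on_single)
    qed
    have "shift u (b - z - ?D b') \<in> supported_on (ideal_cells \<G>)"
    proof (rule additive_supported_on[OF additive_shift b'(2)])
      fix k :: "'v cell" and s :: 'k
      obtain a L where k: "k = (a, L)"
        by (cases k)
      assume "k \<in> ideal_cells \<H>"
      then have "(a + u, L) \<in> ideal_cells \<G>"
        by (auto simp: k ideal_cells_def \<H>_def keys_add_exponents u)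
      then show "shift u (single k s) \<in> supported_on (ideal_cells \<G>)"
        by (simp add: k)
    qed
    moreover have "?D c' = y + (shift u z - ?D w) + shift u (b - z - ?D b')"
      by (simp add: c'_def cell_diff_diff cell_diff_shift additive.diff[OF additive_shift] shift_b)
    ultimately have "?D c' \<in> supported_on (ideal_cells \<G>)"
      using y wz by (simp add: supported_on_add)
    moreover have "c' \<in> supported_on (cells V)"
      unfolding c'_def using w shift_b' less.prems(3) supported_on_mono
      by (intro supported_on_diff) (auto simp: supported_on_def)
    moreover have "\<G> \<subseteq> Pow V" "leafy \<G>"
      using less.prems(1) leafy_subset[OF less.prems(2)] by (auto simp: \<G>_def)
    ultimately have "\<exists>z b. z \<in> supported_on (cells V \<inter> cycle_cells \<G>) \<and> b \<in> supported_on (cells V) \<and>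
        c' - z - ?D b \<in> supported_on (ideal_cells \<G>)"
      by (intro less.hyps[OF card(1)])
    then obtain z' b'' where z': "z' \<in> supported_on (cells V \<inter> cycle_cells \<G>)"
      and b'': "b'' \<in> supported_on (cells V)" "c' - z' - ?D b'' \<in> supported_on (ideal_cells \<G>)"
      by blast
    have mono: "ideal_cells \<G> \<subseteq> ideal_cells \<F>" "cycle_cells \<G> \<subseteq> cycle_cells \<F>"
      by (simp_all add: ideal_cells_mono cycle_cells_mono \<G>_def)
    \<comment> \<open>The multiple \<open>x_F b'\<close> subtracted earlier reappears as an error
      term, harmless because it lies in \<open>I\<close>.\<close>
    have "c - (w + z') - ?D b'' = shift u b' + (c' - z' - ?D b'')"
      by (simp add: c'_def)
    also have "\<dots> \<in> supported_on (ideal_cells \<F>)"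
      using shift_b' b''(2) mono(1) by (intro supported_on_add) (auto simp: supported_on_def)
    finally have "c - (w + z') - ?D b'' \<in> supported_on (ideal_cells \<F>)" .
    moreover have "w + z' \<in> supported_on (cells V \<inter> cycle_cells \<F>)"
      using w z' mono(2) by (intro supported_on_add) (auto simp: supported_on_def)
    ultimately show ?thesis
      using b''(1) by blast
  qed
qed

section \<open>Facets of a forest\<close>

text \<open>For a set of facets of a complex this is the subcomplex having exactly these facets; it
  links the leaf condition on subcomplexes to families of sets.\<close>

definition down_closure :: "'v set set \<Rightarrow> 'v set set" where
  "down_closure S = {A. \<exists>F\<in>S. A \<subseteq> F}"

context
  fixes V :: "'v set" and \<Delta> :: "'v set set"
  assumes complex: "simplicial_complex V \<Delta>"
begin

context
  fixes S :: "'v set set"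
  assumes S: "S \<subseteq> facets \<Delta>"
begin

lemma facets_down_closure: "facets (down_closure S) = S"
proof -
  have *: "F = G" if "F \<in> S" "G \<in> S" "F \<subseteq> G" for F G
    using S that by (auto simp: facets_def)
  show ?thesis
  proof (intro equalityI subsetI)
    fix F assume "F \<in> facets (down_closure S)"
    then show "F \<in> S"
      by (auto simp: facets_def down_closure_def)
  next
    fix F assume F: "F \<in> S"
    have "F = G" if G: "G \<in> down_closure S" "F \<subseteq> G" for G
    proof -
      obtain H where "H \<in> S" "G \<subseteq> H"
        using G(1) by (auto simp: down_closure_def)
      then show ?thesis
        using *[OF F, of H] G(2) by auto
    qed
    then show "F \<in> facets (down_closure S)"
      using F by (auto simp: facets_def down_closure_def)
  qed
qed

lemma simplicial_complex_down_closure: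
  "simplicial_complex (\<Union>(down_closure S)) (down_closure S)"
proof -
  have "\<Union>(down_closure S) \<subseteq> V"
    using S complex by (fastforce simp: down_closure_def facets_def simplicial_complex_def)
  then have "finite (\<Union>(down_closure S))"
    using complex finite_subset by (auto simp: simplicial_complex_def)
  then show ?thesis
    unfolding simplicial_complex_def down_closure_def by blast
qed

end

text \<open>Reachability through intersecting facets is symmetric, which gives connectedness. For
  maximality, a larger connected subcomplex has \<open>F0\<close> among its facets, and its chains
  starting there stay reachable.\<close>

lemma connected_component_reachable:
  assumes F0: "F0 \<in> facets \<Delta>"
  defines "E \<equiv> {(F, G). F \<in> facets \<Delta> \<and> G \<in> facets \<Delta> \<and> F \<inter> G \<noteq> {}}"
  shows "connected_component \<Delta> (down_closure (E\<^sup>* `` {F0}))"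
proof -
  define C where "C = E\<^sup>* `` {F0}"
  have C: "C \<subseteq> facets \<Delta>"
  proof
    fix G assume "G \<in> C"
    then have "(F0, G) \<in> E\<^sup>*"
      by (simp add: C_def)
    then show "G \<in> facets \<Delta>"
      by (induction rule: rtrancl_induct) (auto simp: F0 E_def)
  qed
  have "sym E"
    by (auto simp: E_def sym_def)
  have connected: "connected_complex (down_closure C)"
    unfolding connected_complex_def facets_down_closure[OF C]
  proof (intro ballI)
    fix F G assume F: "F \<in> C" and "G \<in> C"
    then have "(F0, F) \<in> E\<^sup>*" "(F0, G) \<in> E\<^sup>*"
      by (simp_all add: C_def)
    then have "(F, G) \<in> E\<^sup>*"
      using sym_rtrancl[OF \<open>sym E\<close>] by (meson rtrancl_trans symD)
    then obtain m where "(F, G) \<in> E ^^ m"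
      using rtrancl_imp_relpow by blast
    then obtain H where H: "H 0 = F" "H m = G" "\<forall>i<m. (H i, H (Suc i)) \<in> E"
      unfolding relpow_fun_conv by blast
    have "H i \<in> C" if "i \<le> m" for i
      using that
    proof (induction i)
      case (Suc i)
      then have "(F0, H i) \<in> E\<^sup>*" "(H i, H (Suc i)) \<in> E"
        using H(3) by (auto simp: C_def)
      then show ?case
        by (simp add: C_def)
    qed (use F H(1) in simp)
    then show "\<exists>(m::nat) H. H 0 = F \<and> H m = G \<and> (\<forall>i\<le>m. H i \<in> C) \<and> (\<forall>i<m. H i \<inter> H (Suc i) \<noteq> {})"
      using H by (intro exI[of _ m] exI[of _ H]) (auto simp: E_def)
  qed
  have maximal: "\<Gamma> = down_closure C"
    if sub: "subcomplex \<Gamma> \<Delta>" and con: "connected_complex \<Gamma>" and le: "down_closure C \<subseteq> \<Gamma>" for \<Gamma>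
  proof -
    have \<Gamma>: "simplicial_complex (\<Union>\<Gamma>) \<Gamma>" and facets_sub: "facets \<Gamma> \<subseteq> facets \<Delta>"
      using sub by (auto simp: subcomplex_def)
    have above: "\<exists>F\<in>facets \<Gamma>. A \<subseteq> F" if "A \<in> \<Gamma>" for A
    proof -
      have "finite \<Gamma>"
        using \<Gamma> finite_subset[of \<Gamma> "Pow (\<Union>\<Gamma>)"] by (simp add: simplicial_complex_def)
      from finite_has_maximal2[OF this that] show ?thesis
        by (auto simp: facets_def)
    qed
    \<comment> \<open>The facet of \<open>\<Gamma>\<close> above \<open>F0\<close> is a face of
      \<open>\<Delta>\<close>, so maximality of \<open>F0\<close> in \<open>\<Delta>\<close> makes
      them equal.\<close>
    have "F0 \<in> C"
      by (simp add: C_def)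
    then have "F0 \<in> \<Gamma>"
      using le by (auto simp: down_closure_def)
    then obtain F where F: "F \<in> facets \<Gamma>" "F0 \<subseteq> F"
      using above by blast
    have "F \<in> \<Delta>"
      using F(1) facets_sub unfolding facets_def by blast
    then have "F0 = F"
      using F0 F(2) by (simp add: facets_def)
    then have F0': "F0 \<in> facets \<Gamma>"
      using F(1) by simp
    have "facets \<Gamma> \<subseteq> C"
    proof
      fix G assume G: "G \<in> facets \<Gamma>"
      define path where "path m H \<longleftrightarrow> H 0 = F0 \<and> H m = G \<and> (\<forall>i\<le>m. H i \<in> facets \<Gamma>) \<and>
        (\<forall>i<m. H i \<inter> H (Suc i) \<noteq> {})" for m :: nat and H
      have "\<exists>m H. path m H"
        using con F0' G by (simp add: connected_complex_def path_def)
      then obtain m H where "path m H"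
        by blast
      then have H: "H 0 = F0" "H m = G" "\<forall>i\<le>m. H i \<in> facets \<Gamma>" "\<forall>i<m. H i \<inter> H (Suc i) \<noteq> {}"
        by (simp_all add: path_def)
      have "H i \<in> C" if "i \<le> m" for i
        using that
      proof (induction i)
        case (Suc i)
        then have "(F0, H i) \<in> E\<^sup>*" "(H i, H (Suc i)) \<in> E"
          using H(3,4) facets_sub by (auto simp: C_def E_def)
        then show ?case
          by (auto simp: C_def intro: rtrancl_into_rtrancl)
      qed (simp add: H(1) C_def)
      then show "G \<in> C"
        using H(2) by blast
    qed
    then have "A \<in> down_closure C" if "A \<in> \<Gamma>" for A
      using above[OF that] unfolding down_closure_def by blast
    then show ?thesis
      using le by blast
  qed
  have sub: "subcomplex (down_closure C) \<Delta>"
    using simplicial_complex_down_closure[OF C] C by (simp add: subcomplex_def facets_down_closure[OF C])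
  show ?thesis
    unfolding connected_component_def C_def[symmetric]
    by (intro conjI allI impI sub connected; elim conjE) (rule maximal)
qed

end

text \<open>The forest condition speaks about each component separately. A leaf found inside one
  component stays a leaf in all of \<open>S\<close>, because facets of other components are disjoint
  from it.\<close>

lemma leafy_facets_of_forest:
  assumes "simplicial_forest V \<Delta>"
  shows "leafy (facets \<Delta>)"
  unfolding leafy_def
proof (intro allI impI; elim conjE)
  fix S assume S: "S \<subseteq> facets \<Delta>" "S \<noteq> {}"
  have complex: "simplicial_complex V \<Delta>"
    using assms by (simp add: simplicial_forest_def)
  obtain F0 where F0: "F0 \<in> S"
    using S(2) by blast
  define E where "E = {(F, G). F \<in> facets \<Delta> \<and> G \<in> facets \<Delta> \<and> F \<inter> G \<noteq> {}}"
  define C where "C = E\<^sup>* `` {F0}"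
  have component: "connected_component \<Delta> (down_closure C)"
    using connected_component_reachable[OF complex, of F0] F0 S(1) by (auto simp: C_def E_def)
  have C: "C \<subseteq> facets \<Delta>"
  proof
    fix G assume "G \<in> C"
    then have "(F0, G) \<in> E\<^sup>*"
      by (simp add: C_def)
    then show "G \<in> facets \<Delta>"
      by (induction rule: rtrancl_induct) (use F0 S(1) in \<open>auto simp: E_def\<close>)
  qed
  have SC: "S \<inter> C \<subseteq> facets \<Delta>"
    using S(1) by blast
  have "subcomplex (down_closure (S \<inter> C)) (down_closure C)"
    using simplicial_complex_down_closure[OF complex SC]
    by (simp add: subcomplex_def facets_down_closure[OF complex SC] facets_down_closure[OF complex C])
  moreover have "down_closure (S \<inter> C) \<noteq> {}"
    using F0 by (auto simp: down_closure_def C_def)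
  ultimately obtain F where "leaf (down_closure (S \<inter> C)) F"
    using assms component unfolding simplicial_forest_def simplicial_tree_def by blast
  then have F: "F \<in> S \<inter> C" "S \<inter> C = {F} \<or>
      (\<exists>G\<in>S \<inter> C. G \<noteq> F \<and> (\<forall>H\<in>S \<inter> C. H \<noteq> F \<longrightarrow> F \<inter> H \<subseteq> F \<inter> G))"
    unfolding leaf_def facets_down_closure[OF complex SC] by auto
  have disjoint: "F \<inter> H = {}" if "H \<in> S" "H \<notin> C" for H
  proof (rule ccontr)
    assume "F \<inter> H \<noteq> {}"
    then have "(F, H) \<in> E" "(F0, F) \<in> E\<^sup>*"
      using F(1) S(1) that(1) by (auto simp: E_def C_def)
    then show False
      using that(2) by (auto simp: C_def intro: rtrancl_into_rtrancl)
  qed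
  show "\<exists>F\<in>S. S = {F} \<or> (\<exists>G\<in>S - {F}. \<forall>H\<in>S - {F}. F \<inter> H \<subseteq> G)"
  proof (rule bexI[of _ F])
    show "F \<in> S"
      using F(1) by blast
    show "S = {F} \<or> (\<exists>G\<in>S - {F}. \<forall>H\<in>S - {F}. F \<inter> H \<subseteq> G)"
      using F(2)
    proof
      \<comment> \<open>\<open>F\<close> is alone in its component, so it meets no other member of
        \<open>S\<close> and any of them can serve as \<open>G\<close>.\<close>
      assume single: "S \<inter> C = {F}"
      show ?thesis
      proof (cases "S = {F}")
        case False
        then obtain G where "G \<in> S - {F}"
          using \<open>F \<in> S\<close> by blast
        moreover have "F \<inter> H \<subseteq> G" if "H \<in> S - {F}" for H
          using disjoint[of H] single that by blast
        ultimately show ?thesis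
          by blast
      qed simp
    next
      assume "\<exists>G\<in>S \<inter> C. G \<noteq> F \<and> (\<forall>H\<in>S \<inter> C. H \<noteq> F \<longrightarrow> F \<inter> H \<subseteq> F \<inter> G)"
      then obtain G where G: "G \<in> S \<inter> C" "G \<noteq> F" "\<forall>H\<in>S \<inter> C. H \<noteq> F \<longrightarrow> F \<inter> H \<subseteq> F \<inter> G"
        by blast
      have "F \<inter> H \<subseteq> G" if "H \<in> S - {F}" for H
        using disjoint[of H] G(3) that by (cases "H \<in> C") auto
      then show ?thesis
        using G(1,2) by (intro disjI2 bexI[of _ G]) auto
    qed
  qed
qed

section \<open>Vector spaces\<close>

text \<open>Zorn's lemma: the generating set is not assumed to be finite.\<close>

lemma (in vectorspace) gen_set_contains_basis:
  assumes S: "S \<subseteq> carrier V" "gen_set S"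
  shows "\<exists>B\<subseteq>S. basis B"
proof -
  define \<A> where "\<A> = {B. B \<subseteq> S \<and> lin_indpt B}"
  have "\<exists>M\<in>\<A>. \<forall>A\<in>\<A>. M \<subseteq> A \<longrightarrow> A = M"
  proof (rule subset_Zorn_nonempty)
    show "\<A> \<noteq> {}"
      by (auto simp: \<A>_def lin_dep_def)
    fix \<C> assume \<C>: "\<C> \<noteq> {}" "subset.chain \<A> \<C>"
    \<comment> \<open>A dependence relation involves finitely many vectors, and these lie in a
      single member of the chain.\<close>
    have "lin_indpt (\<Union>\<C>)"
    proof
      assume "lin_dep (\<Union>\<C>)"
      then obtain A a v where A: "finite A" "A \<subseteq> \<Union>\<C>" "a \<in> A \<rightarrow> carrier K" "lincomb a A = \<zero>\<^bsub>V\<^esub>"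
        "v \<in> A" "a v \<noteq> \<zero>\<^bsub>K\<^esub>"
        unfolding lin_dep_def by blast
      obtain B where B: "B \<in> \<C>" "A \<subseteq> B"
        using finite_subset_Union_chain[OF A(1,2) \<C>] by blast
      then have "lin_dep B"
        unfolding lin_dep_def using A by blast
      then show False
        using B(1) \<C>(2) by (auto simp: \<A>_def subset.chain_def)
    qed
    then show "\<Union>\<C> \<in> \<A>"
      using \<C>(2) by (auto simp: \<A>_def subset.chain_def)
  qed
  then obtain B where B: "B \<in> \<A>" and max: "\<And>A. A \<in> \<A> \<Longrightarrow> B \<subseteq> A \<Longrightarrow> A = B"
    by blast
  have BS: "B \<subseteq> S" "lin_indpt B" "B \<subseteq> carrier V"
    using B S(1) by (auto simp: \<A>_def)
  have "S \<subseteq> span B"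
  proof
    fix v assume v: "v \<in> S"
    show "v \<in> span B"
    proof (cases "v \<in> B")
      case True
      then show ?thesis
        using in_own_span[OF BS(3)] by blast
    next
      case False
      then have "lin_dep (B \<union> {v})"
        using max[of "B \<union> {v}"] BS v by (auto simp: \<A>_def)
      then show ?thesis
        using lin_dep_iff_in_span[OF BS(3,2) _ False] v S(1) by blast
    qed
  qed
  then have "span S \<subseteq> span B"
    by (rule span_is_subset[OF _ span_is_submodule[OF BS(3)]])
  then have "gen_set B"
    using S(2) span_is_subset2[OF BS(3)] by blast
  then show ?thesis
    unfolding basis_def using BS by blast
qed

context
  fixes scale :: "'k::field \<Rightarrow> 'c::ab_group_add \<Rightarrow> 'c" and S :: "'c set"
    and \<phi> :: "'c \<Rightarrow> 'm" and H :: "('k, 'm) module"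
  assumes scale: "vector_space scale"
    and S: "module.subspace scale S"
    and carrier: "carrier H = \<phi> ` S"
    and zero: "\<zero>\<^bsub>H\<^esub> = \<phi> 0"
    and add: "\<And>x y. x \<in> S \<Longrightarrow> y \<in> S \<Longrightarrow> \<phi> x \<oplus>\<^bsub>H\<^esub> \<phi> y = \<phi> (x + y)"
    and smult: "\<And>s x. x \<in> S \<Longrightarrow> s \<odot>\<^bsub>H\<^esub> \<phi> x = \<phi> (scale s x)"
begin

interpretation vector_space scale
  by (rule scale)

text \<open>An image under a map respecting the operations inherits the vector space axioms. This
  recognises homology as a \<open>K\<close>-space without establishing module axioms for the Koszul
  complex.\<close>

lemma vectorspace_image: "vectorspace (ring_of_type_algebra :: 'k ring) H"
proof (rule vs_criteria)
  show "field (ring_of_type_algebra :: 'k ring)"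
    by (rule field_from_type_algebra)
  have "\<exists>w\<in>S. \<phi> v \<oplus>\<^bsub>H\<^esub> \<phi> w = \<zero>\<^bsub>H\<^esub>" if "v \<in> S" for v
    using that S by (intro bexI[of _ "- v"]) (auto simp: add zero subspace_neg)
  then show "\<forall>v\<in>carrier H. \<exists>w\<in>carrier H. v \<oplus>\<^bsub>H\<^esub> w = \<zero>\<^bsub>H\<^esub>"
    by (auto simp: carrier)
qed (use S in \<open>auto simp: carrier zero add smult subspace_0 subspace_add subspace_scale
    ring_of_type_algebra_def ac_simps scale_left_distrib scale_right_distrib\<close>)

text \<open>\<open>T\<close> has to span \<open>S\<close> only up to equality of images: in the
  application, up to boundaries and chains with coefficients in the ideal.\<close>

lemma gen_set_image:
  assumes T: "T \<subseteq> S" and gen: "\<And>x. x \<in> S \<Longrightarrow> \<exists>y\<in>local.span T. \<phi> x = \<phi> y"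
  shows "carrier H = module.span (ring_of_type_algebra :: 'k ring) H (\<phi> ` T)"
proof -
  let ?K = "ring_of_type_algebra :: 'k ring"
  interpret V: vectorspace ?K H
    by (rule vectorspace_image)
  have T': "\<phi> ` T \<subseteq> carrier H"
    using T by (auto simp: carrier)
  interpret N: submodule ?K "V.span (\<phi> ` T)" H
    by (rule V.span_is_submodule[OF T'])
  have span_S: "local.span T \<subseteq> S"
    using T S by (rule span_minimal)
  \<comment> \<open>Membership in \<open>S\<close> is carried through the induction because
    \<open>add\<close> and \<open>smult\<close> are available only there.\<close>
  have "y \<in> S \<and> \<phi> y \<in> V.span (\<phi> ` T)" if "y \<in> local.span T" for y
    using that
  proof (induction rule: span_induct_alt)
    case base
    then show ?case
      using N.zero_closed S by (simp add: zero subspace_0)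
  next
    case (step s x y)
    have x: "x \<in> S" "\<phi> x \<in> V.span (\<phi> ` T)"
      using T step(1) V.in_own_span[OF T'] by auto
    have "s \<odot>\<^bsub>H\<^esub> \<phi> x \<oplus>\<^bsub>H\<^esub> \<phi> y \<in> V.span (\<phi> ` T)"
      using x step(2) by (intro N.m_closed N.smult_closed) (auto simp: ring_of_type_algebra_def)
    then show ?case
      using x step S by (simp add: smult add subspace_scale subspace_add)
  qed
  then have "carrier H \<subseteq> V.span (\<phi> ` T)"
    using gen by (fastforce simp: carrier)
  then show ?thesis
    using V.span_is_subset2[OF T'] by blast
qed

lemma basis_in_image:
  assumes "T \<subseteq> S" and "\<And>x. x \<in> S \<Longrightarrow> \<exists>y\<in>local.span T. \<phi> x = \<phi> y"
  shows "\<exists>B\<subseteq>\<phi> ` T. vectorspace.basis (ring_of_type_algebra :: 'k ring) H B"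
proof (rule vectorspace.gen_set_contains_basis[OF vectorspace_image])
  show "\<phi> ` T \<subseteq> carrier H"
    using assms(1) by (auto simp: carrier)
qed (rule gen_set_image[OF assms, symmetric])

end

section \<open>The polynomial ring and its monomial ideals\<close>

lemma cring_mpoly_ring: "cring (mpoly_ring V :: ('v, 'k::field) mpoly ring)"
proof -
  let ?A = "ring_of_type_algebra :: ('v, 'k) mpoly ring"
  let ?P = "{p :: ('v, 'k) mpoly. \<forall>a\<in>keys p. keys a \<subseteq> V}"
  interpret cring ?A
    by (rule cring_from_type_algebra)
  have neg: "\<ominus>\<^bsub>?A\<^esub> p = - p" for p
    by (rule minus_equality) (auto simp: ring_of_type_algebra_def)
  have "subring ?P ?A"
  proof (rule subringI)
    fix p q assume pq: "p \<in> ?P" "q \<in> ?P"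
    show "p \<otimes>\<^bsub>?A\<^esub> q \<in> ?P"
    proof (clarsimp simp: ring_of_type_algebra_def)
      fix a x assume "a \<in> keys (p * q)" "x \<in> keys a"
      then show "x \<in> V"
        using pq keys_mult[of p q] by (fastforce simp: keys_add_exponents)
    qed
    show "p \<oplus>\<^bsub>?A\<^esub> q \<in> ?P"
      using pq keys_add[of p q] by (auto simp: ring_of_type_algebra_def)
  next
    fix p assume "p \<in> ?P"
    then show "\<ominus>\<^bsub>?A\<^esub> p \<in> ?P"
      by (auto simp: neg in_keys_iff)
  qed (auto simp: ring_of_type_algebra_def)
  then show ?thesis
    using subcring_iff[of ?P] subcringI'[of ?P] by (simp add: mpoly_ring_def ring_of_type_algebra_def)
qed

definition monomial_ideal :: "'v set \<Rightarrow> 'v set set \<Rightarrow> ('v, 'k::field) mpoly set" where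
  "monomial_ideal V \<F> = {p. \<forall>a\<in>keys p. keys a \<subseteq> V \<and> (\<exists>H\<in>\<F>. H \<subseteq> keys a)}"

lemma mpoly_ring_simps [simp]:
  "carrier (mpoly_ring V) = {p. \<forall>a\<in>keys p. keys a \<subseteq> V}"
  "p \<otimes>\<^bsub>mpoly_ring V\<^esub> q = p * q" "p \<oplus>\<^bsub>mpoly_ring V\<^esub> q = p + q"
  "\<one>\<^bsub>mpoly_ring V\<^esub> = 1" "\<zero>\<^bsub>mpoly_ring V\<^esub> = 0"
  by (simp_all add: mpoly_ring_def ring_of_type_algebra_def)

lemma mpoly_ring_uminus:
  assumes "p \<in> carrier (mpoly_ring V)"
  shows "\<ominus>\<^bsub>mpoly_ring V\<^esub> p = - p"
proof -
  interpret cring "mpoly_ring V :: ('a, 'b) mpoly ring"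
    by (rule cring_mpoly_ring)
  show ?thesis
    by (rule minus_equality) (use assms in \<open>auto simp: in_keys_iff\<close>)
qed

lemma mvar_eq_single: "mvar i = single (evar i) 1"
  by (simp add: mvar_def mmonomial_def evar_def)

lemma prod_mvar:
  assumes "finite F"
  shows "(\<Prod>i\<in>F. mvar i :: ('v, 'k::field) mpoly) = single (\<Sum>i\<in>F. evar i) 1"
  using assms by induction (simp_all add: mvar_eq_single mult_single)

lemma ideal_monomial_ideal:
  "ideal (monomial_ideal V \<F> :: ('v, 'k::field) mpoly set) (mpoly_ring V)"
proof -
  interpret cring "mpoly_ring V :: ('v, 'k) mpoly ring"
    by (rule cring_mpoly_ring)
  have mult: "q * p \<in> monomial_ideal V \<F>"
    if "p \<in> monomial_ideal V \<F>" "q \<in> carrier (mpoly_ring V)" for p q :: "('v, 'k) mpoly"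
  proof -
    have "keys c \<subseteq> V \<and> (\<exists>H\<in>\<F>. H \<subseteq> keys c)" if c: "c \<in> keys (q * p)" for c
    proof -
      obtain a b where ab: "c = a + b" "a \<in> keys q" "b \<in> keys p"
        using c keys_mult[of q p] by blast
      have "keys b \<subseteq> V" "\<exists>H\<in>\<F>. H \<subseteq> keys b" "keys a \<subseteq> V"
        using \<open>p \<in> monomial_ideal V \<F>\<close> \<open>q \<in> carrier (mpoly_ring V)\<close> ab
        by (auto simp: monomial_ideal_def)
      then show ?thesis
        unfolding ab(1) keys_add_exponents by blast
    qed
    then show ?thesis
      by (simp add: monomial_ideal_def)
  qed
  show ?thesis
  proof (rule idealI)
    show "ring (mpoly_ring V :: ('v, 'k) mpoly ring)"
      by (rule ring_axioms)
    show "subgroup (monomial_ideal V \<F>) (add_monoid (mpoly_ring V :: ('v, 'k) mpoly ring))"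
    proof (rule add.subgroupI)
      fix p q :: "('v, 'k) mpoly" assume pq: "p \<in> monomial_ideal V \<F>" "q \<in> monomial_ideal V \<F>"
      then show "p \<oplus>\<^bsub>mpoly_ring V\<^esub> q \<in> monomial_ideal V \<F>"
        using keys_add[of p q] by (auto simp: monomial_ideal_def)
    next
      fix p :: "('v, 'k) mpoly" assume p: "p \<in> monomial_ideal V \<F>"
      then have "- p \<in> monomial_ideal V \<F>" "p \<in> carrier (mpoly_ring V)"
        by (auto simp: monomial_ideal_def in_keys_iff)
      then show "\<ominus>\<^bsub>mpoly_ring V\<^esub> p \<in> monomial_ideal V \<F>"
        by (simp only: mpoly_ring_uminus)
    next
      show "monomial_ideal V \<F> \<noteq> {}"
        by (auto simp: monomial_ideal_def intro!: exI[of _ 0])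
    qed (auto simp: monomial_ideal_def)
  qed (use mult in \<open>auto simp: mult.commute\<close>)
qed

text \<open>Each term of a polynomial on the right is a multiple of a generator, and the right-hand
  side is itself an ideal containing the generators. This turns ideal membership into the support
  condition used for cells.\<close>

lemma facet_ideal_eq:
  assumes V: "finite V" and sub: "facets \<Delta> \<subseteq> Pow V"
  shows "facet_ideal V \<Delta> = (monomial_ideal V (facets \<Delta>) :: ('v, 'k::field) mpoly set)"
proof -
  let ?R = "mpoly_ring V :: ('v, 'k) mpoly ring"
  let ?G = "(\<lambda>F. \<Prod>i\<in>F. mvar i :: ('v, 'k) mpoly) ` facets \<Delta>"
  interpret cring ?R
    by (rule cring_mpoly_ring)
  have fin: "finite F" "F \<subseteq> V" if "F \<in> facets \<Delta>" for F
    using that sub V finite_subset[of F V] by auto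
  have in_V: "x \<in> V" if "F \<in> facets \<Delta>" "x \<in> F" for x F
    using that sub by blast
  have gen: "?G \<subseteq> carrier ?R"
    using fin(1) by (auto simp: prod_mvar keys_sum_evar intro: in_V)
  interpret I: ideal "genideal ?R ?G" ?R
    by (rule genideal_ideal[OF gen])
  have "single a s \<in> genideal ?R ?G" if a: "keys a \<subseteq> V" "F \<in> facets \<Delta>" "F \<subseteq> keys a" for a F and s :: 'k
  proof -
    let ?u = "\<Sum>i\<in>F. evar i"
    have "single (a - ?u) s \<otimes>\<^bsub>?R\<^esub> (\<Prod>i\<in>F. mvar i) \<in> genideal ?R ?G"
    proof (rule I.I_l_closed)
      show "(\<Prod>i\<in>F. mvar i) \<in> genideal ?R ?G"
        using genideal_self[OF gen] a(2) by blast
      show "single (a - ?u) s \<in> carrier ?R"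
        using a(1) by (auto simp: in_keys_iff lookup_minus)
    qed
    then show ?thesis
      using fin[OF a(2)] a(3) by (simp add: prod_mvar mult_single exponent_diff_add)
  qed
  then have monom: "single a (lookup p a) \<in> genideal ?R ?G"
    if "p \<in> monomial_ideal V (facets \<Delta>)" "a \<in> keys p" for p a
    using that by (auto simp: monomial_ideal_def)
  have sum: "(\<Sum>a\<in>A. single a (lookup p a)) \<in> genideal ?R ?G"
    if "p \<in> monomial_ideal V (facets \<Delta>)" "finite A" "A \<subseteq> keys p" for A p
    using that(2,3)
  proof (induction A)
    case empty
    show ?case
      using I.zero_closed by simp
  next
    case (insert a A)
    then show ?case
      using I.a_closed monom[OF that(1)] by simp
  qed
  have "monomial_ideal V (facets \<Delta>) \<subseteq> genideal ?R ?G"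
  proof
    fix p :: "('v, 'k) mpoly" assume "p \<in> monomial_ideal V (facets \<Delta>)"
    from sum[OF this finite_keys order_refl] show "p \<in> genideal ?R ?G"
      by (simp flip: poly_mapping_sum_single)
  qed
  moreover have "genideal ?R ?G \<subseteq> monomial_ideal V (facets \<Delta>)"
  proof (rule genideal_minimal[OF ideal_monomial_ideal])
    show "?G \<subseteq> monomial_ideal V (facets \<Delta>)"
      using fin(1) by (auto simp: prod_mvar keys_sum_evar monomial_ideal_def intro: in_V)
  qed
  ultimately show ?thesis
    unfolding facet_ideal_def by (rule subset_antisym[rotated])
qed

section \<open>Lifting Koszul homology to the polynomial ring\<close>

text \<open>The bridge between the two encodings of a chain: one finitely supported map on cells,
  and a family of polynomials indexed by \<open>L\<close>.\<close>

definition coefficient :: "'v set \<Rightarrow> ('v cell \<Rightarrow>\<^sub>0 'k::zero) \<Rightarrow> ('v, 'k) mpoly" where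
  "coefficient L = Poly_Mapping.map_key (\<lambda>a. (a, L))"

lemma lookup_coefficient: "lookup (coefficient L c) a = lookup c (a, L)"
  unfolding coefficient_def by (subst map_key.rep_eq) (auto simp: inj_def)

lemma coefficient_add: "coefficient L (c + d) = coefficient L c + coefficient L d"
  for c d :: "'v cell \<Rightarrow>\<^sub>0 'k::monoid_add"
  by (rule poly_mapping_eqI) (simp add: lookup_coefficient lookup_add)

lemma coefficient_diff: "coefficient L (c - d) = coefficient L c - coefficient L d"
  for c d :: "'v cell \<Rightarrow>\<^sub>0 'k::ab_group_add"
  by (rule poly_mapping_eqI) (simp add: lookup_coefficient lookup_minus)

lemma additive_coefficient: "additive (coefficient L)"
  by (simp add: additive_def coefficient_add)

lemma coefficient_zero [simp]: "coefficient L 0 = 0"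
  by (rule poly_mapping_eqI) (simp add: lookup_coefficient)

lemma coefficient_single: "coefficient J (single (a, L) s) = (if J = L then single a s else 0)"
  by (rule poly_mapping_eqI) (auto simp: lookup_coefficient lookup_single when_def)

lemma coefficient_in_mpoly_ring:
  "c \<in> supported_on (cells V) \<Longrightarrow> coefficient L c \<in> carrier (mpoly_ring V)"
  by (auto simp: supported_on_def cells_def in_keys_iff lookup_coefficient)

lemma koszul_sign_eq_single: "koszul_sign i L = (single 0 (koszul_sign i L) :: ('v::linorder, 'k::field) mpoly)"
  by (simp add: koszul_sign_def minus_one_power_iff single_uminus)

text \<open>\<open>cell_diff\<close> sums over the sources \<open>L\<close>, the given differential
  over the targets \<open>J\<close>. The change of index is \<open>L = insert i J\<close>, under
  which the sign is unchanged.\<close>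

lemma coefficient_cell_diff:
  fixes c :: "'v::linorder cell \<Rightarrow>\<^sub>0 'k::field"
  assumes c: "c \<in> supported_on (cells V)" and V: "finite V" and J: "J \<subseteq> V"
  shows "coefficient J (cell_diff c) = (\<Sum>i\<in>V - J. koszul_sign i J * mvar i * coefficient (insert i J) c)"
proof (rule additive_eqI[where f = "\<lambda>c. coefficient J (cell_diff c)"
      and g = "\<lambda>c. \<Sum>i\<in>V - J. koszul_sign i J * mvar i * coefficient (insert i J) c", OF _ _ c])
  show "additive (\<lambda>c :: 'v cell \<Rightarrow>\<^sub>0 'k. coefficient J (cell_diff c))"
    by (rule additive_comp[OF additive_coefficient additive_cell_diff])
  show "additive (\<lambda>c :: 'v cell \<Rightarrow>\<^sub>0 'k. \<Sum>i\<in>V - J. koszul_sign i J * mvar i * coefficient (insert i J) c)"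
    by (simp add: additive_def coefficient_add distrib_left sum.distrib)
  fix k :: "'v cell" and s :: 'k
  obtain a L where k: "k = (a, L)"
    by (cases k)
  assume "k \<in> cells V"
  then have L: "L \<subseteq> V" "finite L"
    using V finite_subset by (auto simp: k cells_def)
  have "coefficient J (cell_diff (single k s))
      = (\<Sum>i\<in>L. if J = L - {i} then single (a + evar i) (koszul_sign i L * s) else 0)"
    by (simp add: k cell_diff_single additive.sum[OF additive_coefficient] coefficient_single)
  also have "\<dots> = (\<Sum>i\<in>V - J. if insert i J = L then single (a + evar i) (koszul_sign i J * s) else 0)"
  proof (rule sum.mono_neutral_cong)
    show "(if J = L - {i} then single (a + evar i) (koszul_sign i L * s) else 0)
      = (if insert i J = L then single (a + evar i) (koszul_sign i J * s) else 0)"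
      if "i \<in> L \<inter> (V - J)" for i
    proof -
      have iff: "J = L - {i} \<longleftrightarrow> insert i J = L"
        using that by auto
      show ?thesis
      proof (cases "insert i J = L")
        case True
        then have "koszul_sign i L = (koszul_sign i J :: 'k)"
          using koszul_sign_insert[of i J] by simp
        then show ?thesis
          unfolding iff by simp
      qed (simp add: iff)
    qed
  qed (use L V in auto)
  also have "\<dots> = (\<Sum>i\<in>V - J. koszul_sign i J * mvar i * coefficient (insert i J) (single k s))"
    by (intro sum.cong refl)
      (simp add: k coefficient_single koszul_sign_eq_single mvar_eq_single mult_single ac_simps)
  finally show "coefficient J (cell_diff (single k s))
    = (\<Sum>i\<in>V - J. koszul_sign i J * mvar i * coefficient (insert i J) (single k s))" .
qed

definition scale :: "'k \<Rightarrow> ('a \<Rightarrow>\<^sub>0 'k) \<Rightarrow> ('a \<Rightarrow>\<^sub>0 'k::field)" where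
  "scale s = Poly_Mapping.map ((*) s)"

lemma lookup_scale: "lookup (scale s c) k = s * lookup c k"
  by (simp add: scale_def map.rep_eq when_def)

lemma vector_space_scale: "vector_space scale"
  by unfold_locales
    (auto intro!: poly_mapping_eqI simp: lookup_scale lookup_add distrib_left distrib_right)

interpretation scale: vector_space scale
  by (rule vector_space_scale)

lemma scale_single: "scale s (single k t) = single k (s * t)"
  by (rule poly_mapping_eqI) (simp add: lookup_scale lookup_single when_def)

lemma supported_on_scale: "c \<in> supported_on A \<Longrightarrow> scale s c \<in> supported_on A"
  by (simp add: supported_on_iff lookup_scale)

lemma cell_diff_scale:
  fixes c :: "'v::linorder cell \<Rightarrow>\<^sub>0 'k::field"
  shows "cell_diff (scale s c) = scale s (cell_diff c)"
proof -
  have scale: "additive (scale s :: ('v cell \<Rightarrow>\<^sub>0 'k) \<Rightarrow> _)"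
    by (simp add: additive_def scale.scale_right_distrib)
  have c: "c \<in> supported_on UNIV"
    by (simp add: supported_on_def)
  show ?thesis
  proof (rule additive_eqI[OF additive_comp[OF additive_cell_diff scale]
        additive_comp[OF scale additive_cell_diff] c])
    fix k :: "'v cell" and t :: 'k
    show "cell_diff (scale s (single k t)) = scale s (cell_diff (single k t))"
      by (cases k) (simp add: cell_diff_single scale_single additive.sum[OF scale] ac_simps)
  qed
qed

lemma coefficient_scale:
  fixes c :: "'v cell \<Rightarrow>\<^sub>0 'k::field"
  shows "coefficient L (scale s c) = mconst s * coefficient L c"
proof -
  have "mconst s * single a t = (single a (s * t) :: ('v, 'k) mpoly)" for a t
    by (simp add: mconst_def mult_single)
  then have "mconst s * (\<Sum>a\<in>keys p. single a (lookup p a)) = scale s (\<Sum>a\<in>keys p. single a (lookup p a))"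
    for p :: "('v, 'k) mpoly"
    by (simp add: sum_distrib_left scale.scale_sum_right scale_single)
  then have "mconst s * p = scale s p" for p :: "('v, 'k) mpoly"
    by (simp flip: poly_mapping_sum_single)
  then show ?thesis
    by (simp add: poly_mapping_eq_iff fun_eq_iff lookup_scale lookup_coefficient)
qed

definition degree_cells :: "nat \<Rightarrow> 'v cell set" where
  "degree_cells r = {(a, L). card L = r}"

text \<open>The differential lowers the homological degree by exactly one. Hence a decomposition
  found regardless of degree can be projected to a single degree.\<close>

lemma cell_diff_degree:
  fixes c :: "'v::linorder cell \<Rightarrow>\<^sub>0 'k::comm_ring_1"
  assumes "c \<in> supported_on (cells V)" "finite V"
  shows "cell_diff (restr (degree_cells (Suc r)) c) = restr (degree_cells r) (cell_diff c)"
proof (rule additive_eqI[OF additive_comp[OF additive_cell_diff additive_restr]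
      additive_comp[OF additive_restr additive_cell_diff] assms(1)])
  fix k :: "'v cell" and s :: 'k
  obtain a L where k: "k = (a, L)"
    by (cases k)
  assume "k \<in> cells V"
  then have "finite L"
    using assms(2) finite_subset by (auto simp: k cells_def)
  have card: "card (L - {i}) = r \<longleftrightarrow> card L = Suc r" if "i \<in> L" for i
    using card_Suc_Diff1[OF \<open>finite L\<close> that] by auto
  show "cell_diff (restr (degree_cells (Suc r)) (single k s)) = restr (degree_cells r) (cell_diff (single k s))"
    using card by (auto simp: k degree_cells_def cell_diff_single cell_diff_zero
        additive.sum[OF additive_restr] intro!: sum.cong sum.neutral[symmetric])
qed

locale monomial_quotient =
  fixes V :: "'v::linorder set" and \<F> :: "'v set set" and I :: "('v, 'k::field) mpoly set"
  assumes V: "finite V" and I_eq: "I = monomial_ideal V \<F>"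
begin

abbreviation R :: "('v, 'k) mpoly ring" where
  "R \<equiv> mpoly_ring V"

abbreviation M :: "(('v, 'k) mpoly, ('v, 'k) mpoly set) module" where
  "M \<equiv> quot_poly V I"

sublocale R: cring R
  by (rule cring_mpoly_ring)

sublocale I: ideal I R
  unfolding I_eq by (rule ideal_monomial_ideal)

lemma I_supported_on: "I = supported_on {a. keys a \<subseteq> V \<and> (\<exists>H\<in>\<F>. H \<subseteq> keys a)}"
  unfolding I_eq monomial_ideal_def supported_on_def by blast

lemma coset_eq_iff: "I +>\<^bsub>R\<^esub> p = I +>\<^bsub>R\<^esub> q \<longleftrightarrow> p - q \<in> I"
proof -
  have *: "I +>\<^bsub>R\<^esub> p = {h + p | h. h \<in> I}" for p
    by (auto simp: a_r_coset_def')
  show ?thesis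
  proof
    assume "I +>\<^bsub>R\<^esub> p = I +>\<^bsub>R\<^esub> q"
    moreover have "0 + p \<in> I +>\<^bsub>R\<^esub> p"
      unfolding * using I.zero_closed by auto
    ultimately show "p - q \<in> I"
      unfolding * by auto
  next
    assume pq: "p - q \<in> I"
    have "h + p = (h + (p - q)) + q" "h + q = (h - (p - q)) + p" for h
      by simp_all
    then show "I +>\<^bsub>R\<^esub> p = I +>\<^bsub>R\<^esub> q"
      unfolding * using supported_on_add supported_on_diff pq unfolding I_supported_on by blast
  qed
qed

lemma coset_zero: "I +>\<^bsub>R\<^esub> 0 = I"
  by (auto simp: a_r_coset_def')

lemma quot_zero: "\<zero>\<^bsub>M\<^esub> = I +>\<^bsub>R\<^esub> 0"
  by (simp add: quotient_ring_module_def FactRing_def coset_zero)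

lemma quot_carrier: "carrier M = (\<lambda>p. I +>\<^bsub>R\<^esub> p) ` carrier R"
  by (auto simp: quotient_ring_module_def FactRing_def A_RCOSETS_def')

lemma quot_add:
  "p \<in> carrier R \<Longrightarrow> q \<in> carrier R \<Longrightarrow> (I +>\<^bsub>R\<^esub> p) \<oplus>\<^bsub>M\<^esub> (I +>\<^bsub>R\<^esub> q) = I +>\<^bsub>R\<^esub> (p + q)"
  using ring_hom_add[OF I.rcos_ring_hom, of p q] by (simp add: quotient_ring_module_def)

lemma quot_smult:
  "p \<in> carrier R \<Longrightarrow> q \<in> carrier R \<Longrightarrow> p \<odot>\<^bsub>M\<^esub> (I +>\<^bsub>R\<^esub> q) = I +>\<^bsub>R\<^esub> (p * q)"
  using ring_hom_mult[OF I.rcos_ring_hom, of p q] by (simp add: quotient_ring_module_def)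

lemma quot_finsum:
  assumes "finite A" "\<And>i. i \<in> A \<Longrightarrow> f i \<in> carrier R"
    "\<And>i. i \<in> A \<Longrightarrow> g i = I +>\<^bsub>R\<^esub> f i"
  shows "(\<Oplus>\<^bsub>M\<^esub>i\<in>A. g i) = I +>\<^bsub>R\<^esub> (\<Sum>i\<in>A. f i)"
proof -
  interpret Q: ring "R Quot I"
    by (rule I.quotient_is_ring)
  \<comment> \<open>Finite sums depend only on carrier, addition and zero, which the two records
    share; so the laws of the quotient ring apply to \<open>M\<close>.\<close>
  have eq: "finsum M = finsum (R Quot I)"
    by (rule ext)+ (simp add: finsum_def finprod_def quotient_ring_module_def)
  have sum: "(\<Sum>i\<in>A. f i) \<in> carrier R" if "finite A" "\<And>i. i \<in> A \<Longrightarrow> f i \<in> carrier R" for A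
    using that
  proof (induction A)
    case (insert x A)
    then have "f x \<oplus>\<^bsub>R\<^esub> (\<Sum>i\<in>A. f i) \<in> carrier R"
      by (intro R.a_closed) auto
    then show ?case
      using insert.hyps by (simp del: mpoly_ring_simps(1))
  qed simp
  have coset: "I +>\<^bsub>R\<^esub> p \<in> carrier (R Quot I)" if "p \<in> carrier R" for p
    using ring_hom_closed[OF I.rcos_ring_hom that] .
  show ?thesis
    unfolding eq using assms
  proof (induction A)
    case empty
    show ?case
      unfolding Q.finsum_empty sum.empty coset_zero by (simp add: FactRing_def)
  next
    case (insert x A)
    have "f x \<in> carrier R" "(\<Sum>i\<in>A. f i) \<in> carrier R"
      using insert.prems insert.hyps(1) sum[of A] by auto
    then show ?case
      using insert quot_add[of "f x" "\<Sum>i\<in>A. f i"] coset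
      by (simp add: quotient_ring_module_def Pi_def del: mpoly_ring_simps(1))
  qed
qed

definition to_koszul :: "('v cell \<Rightarrow>\<^sub>0 'k) \<Rightarrow> ('v set \<Rightarrow> ('v, 'k) mpoly set)" where
  "to_koszul c = (\<lambda>L\<in>Pow V. I +>\<^bsub>R\<^esub> coefficient L c)"

text \<open>The kernel of reduction modulo \<open>I\<close>, read off from supports; every later
  statement about the quotient complex is translated to lifts through it.\<close>

lemma to_koszul_eq_iff:
  assumes "c \<in> supported_on (cells V)" "d \<in> supported_on (cells V)"
  shows "to_koszul c = to_koszul d \<longleftrightarrow> c - d \<in> supported_on (ideal_cells \<F>)"
proof -
  have cells: "c - d \<in> supported_on (cells V)"
    using assms by (rule supported_on_diff)
  have "to_koszul c = to_koszul d \<longleftrightarrow> (\<forall>L\<in>Pow V. coefficient L (c - d) \<in> I)"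
    by (auto simp: to_koszul_def fun_eq_iff restrict_def coset_eq_iff coefficient_diff)
  also have "\<dots> \<longleftrightarrow> c - d \<in> supported_on (ideal_cells \<F>)"
  proof
    assume *: "\<forall>L\<in>Pow V. coefficient L (c - d) \<in> I"
    show "c - d \<in> supported_on (ideal_cells \<F>)"
      unfolding supported_on_def
    proof (clarify)
      fix a L assume k: "(a, L) \<in> keys (c - d)"
      then have "L \<in> Pow V"
        using cells by (auto simp: supported_on_def cells_def)
      moreover have "a \<in> keys (coefficient L (c - d))"
        using k by (simp add: in_keys_iff lookup_coefficient)
      ultimately show "(a, L) \<in> ideal_cells \<F>"
        using * by (auto simp: I_eq monomial_ideal_def ideal_cells_def)
    qed
  next
    assume *: "c - d \<in> supported_on (ideal_cells \<F>)"
    show "\<forall>L\<in>Pow V. coefficient L (c - d) \<in> I"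
    proof
      fix L assume "L \<in> Pow V"
      show "coefficient L (c - d) \<in> I"
        unfolding I_supported_on supported_on_def
      proof (clarify)
        fix a assume "a \<in> keys (coefficient L (c - d))"
        then have "(a, L) \<in> keys (c - d)"
          by (simp add: in_keys_iff lookup_coefficient)
        then have "(a, L) \<in> cells V" "(a, L) \<in> ideal_cells \<F>"
          using * cells by (auto simp: supported_on_def)
        then show "keys a \<subseteq> V \<and> (\<exists>H\<in>\<F>. H \<subseteq> keys a)"
          by (simp add: cells_def ideal_cells_def)
      qed
    qed
  qed
  finally show ?thesis .
qed

lemma koszul_zero: "\<zero>\<^bsub>koszul V M\<^esub> = to_koszul 0"
  by (simp add: koszul_def to_koszul_def quot_zero)

lemma koszul_add:
  assumes "c \<in> supported_on (cells V)" "d \<in> supported_on (cells V)"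
  shows "to_koszul c \<oplus>\<^bsub>koszul V M\<^esub> to_koszul d = to_koszul (c + d)"
  using assms by (auto simp: koszul_def to_koszul_def quot_add coefficient_in_mpoly_ring coefficient_add
      simp del: mpoly_ring_simps(1) intro!: restrict_ext)

lemma koszul_smult:
  assumes "c \<in> supported_on (cells V)"
  shows "mconst s \<odot>\<^bsub>koszul V M\<^esub> to_koszul c = to_koszul (scale s c)"
proof -
  have "mconst s \<in> carrier R"
    by (auto simp: mconst_def)
  then show ?thesis
    using assms by (auto simp: koszul_def to_koszul_def quot_smult coefficient_in_mpoly_ring coefficient_scale
        simp del: mpoly_ring_simps(1) intro!: restrict_ext)
qed

lemma koszul_carrier: "carrier (koszul V M) = to_koszul ` supported_on (cells V)"
proof (intro equalityI subsetI)
  fix f assume f: "f \<in> carrier (koszul V M)"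
  have "\<forall>L\<in>Pow V. \<exists>p\<in>carrier R. f L = I +>\<^bsub>R\<^esub> p"
  proof
    fix L assume "L \<in> Pow V"
    then have "f L \<in> carrier M"
      using f by (simp add: koszul_def PiE_iff)
    then show "\<exists>p\<in>carrier R. f L = I +>\<^bsub>R\<^esub> p"
      unfolding quot_carrier by blast
  qed
  then obtain P where P: "\<And>L. L \<in> Pow V \<Longrightarrow> P L \<in> carrier R" "\<And>L. L \<in> Pow V \<Longrightarrow> f L = I +>\<^bsub>R\<^esub> P L"
    by metis
  define c where "c = (\<Sum>L\<in>Pow V. \<Sum>a\<in>keys (P L). single (a, L) (lookup (P L) a))"
  have "c \<in> supported_on (cells V)"
    unfolding c_def using P(1)
    by (intro supported_on_sum supported_on_single) (auto simp: cells_def)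
  moreover have "coefficient L c = P L" if L: "L \<in> Pow V" for L
  proof -
    have "coefficient L c = (\<Sum>L'\<in>Pow V. if L = L' then P L else 0)"
      unfolding c_def additive.sum[OF additive_coefficient]
      by (intro sum.cong refl) (auto simp: coefficient_single simp flip: poly_mapping_sum_single)
    also have "\<dots> = P L"
      using L V by simp
    finally show ?thesis .
  qed
  then have "f = to_koszul c"
    using f P(2) by (auto simp: koszul_def to_koszul_def PiE_iff extensional_def fun_eq_iff)
  ultimately show "f \<in> to_koszul ` supported_on (cells V)"
    by blast
next
  fix f assume "f \<in> to_koszul ` supported_on (cells V)"
  then obtain c where c: "c \<in> supported_on (cells V)" "f = to_koszul c"
    by blast
  show "f \<in> carrier (koszul V M)"
    unfolding c(2) koszul_def to_koszul_def
    by (simp add: restrict_PiE_iff quot_carrier coefficient_in_mpoly_ring[OF c(1)] del: mpoly_ring_simps(1))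
qed

text \<open>Reduction modulo \<open>I\<close> is a chain map, so cycles and boundaries of the
  quotient can be described by lifts.\<close>

lemma koszul_diff_to_koszul:
  assumes c: "c \<in> supported_on (cells V)"
  shows "koszul_diff R V mvar M (to_koszul c) = to_koszul (cell_diff c)"
  unfolding koszul_diff_def to_koszul_def
proof (rule restrict_ext)
  fix J assume J: "J \<in> Pow V"
  have minus_one: "\<ominus>\<^bsub>R\<^esub> \<one>\<^bsub>R\<^esub> = - 1"
    by (simp add: mpoly_ring_uminus)
  have pow: "(- 1) [^]\<^bsub>R\<^esub> n = (- 1) ^ n" for n :: nat
    by (induction n) (simp_all add: nat_pow_def mult.commute)
  have mvar: "koszul_sign i J * mvar i \<in> carrier R" if "i \<in> V" for i
    using that unfolding koszul_sign_eq_single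
    by (auto simp: mvar_eq_single mult_single)
  have prod: "koszul_sign i J * mvar i * coefficient (insert i J) c \<in> carrier R" if "i \<in> V" for i
    using R.m_closed[OF mvar[OF that] coefficient_in_mpoly_ring[OF c]] by (simp only: mpoly_ring_simps(2))
  have smult: "((\<ominus>\<^bsub>R\<^esub> \<one>\<^bsub>R\<^esub>) [^]\<^bsub>R\<^esub> card {j \<in> J. j < i} \<otimes>\<^bsub>R\<^esub> mvar i) \<odot>\<^bsub>M\<^esub>
      (\<lambda>L\<in>Pow V. I +>\<^bsub>R\<^esub> coefficient L c) (insert i J)
      = I +>\<^bsub>R\<^esub> (koszul_sign i J * mvar i * coefficient (insert i J) c)" if "i \<in> V - J" for i
  proof -
    have eq: "(\<ominus>\<^bsub>R\<^esub> \<one>\<^bsub>R\<^esub>) [^]\<^bsub>R\<^esub> card {j \<in> J. j < i} \<otimes>\<^bsub>R\<^esub> mvar i = koszul_sign i J * mvar i"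
      unfolding minus_one pow koszul_sign_def by simp
    show ?thesis
      unfolding eq using quot_smult[OF mvar coefficient_in_mpoly_ring[OF c], of i "insert i J"] that J by simp
  qed
  have "(\<Oplus>\<^bsub>M\<^esub>i\<in>V - J. ((\<ominus>\<^bsub>R\<^esub> \<one>\<^bsub>R\<^esub>) [^]\<^bsub>R\<^esub> card {j \<in> J. j < i} \<otimes>\<^bsub>R\<^esub> mvar i) \<odot>\<^bsub>M\<^esub>
        (\<lambda>L\<in>Pow V. I +>\<^bsub>R\<^esub> coefficient L c) (insert i J))
      = I +>\<^bsub>R\<^esub> (\<Sum>i\<in>V - J. koszul_sign i J * mvar i * coefficient (insert i J) c)"
    using V by (intro quot_finsum prod smult) auto
  then show "(\<Oplus>\<^bsub>M\<^esub>i\<in>V - J. ((\<ominus>\<^bsub>R\<^esub> \<one>\<^bsub>R\<^esub>) [^]\<^bsub>R\<^esub> card {j \<in> J. j < i} \<otimes>\<^bsub>R\<^esub> mvar i) \<odot>\<^bsub>M\<^esub>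
        (\<lambda>L\<in>Pow V. I +>\<^bsub>R\<^esub> coefficient L c) (insert i J))
      = I +>\<^bsub>R\<^esub> coefficient J (cell_diff c)"
    using coefficient_cell_diff[OF c V] J by simp
qed

section \<open>Koszul homology\<close>

definition chains :: "nat \<Rightarrow> ('v cell \<Rightarrow>\<^sub>0 'k) set" where
  "chains r = supported_on (cells V \<inter> degree_cells r)"

definition cycles :: "nat \<Rightarrow> ('v cell \<Rightarrow>\<^sub>0 'k) set" where
  "cycles r = {c \<in> chains r. cell_diff c \<in> supported_on (ideal_cells \<F>)}"

lemma chains_cells: "c \<in> chains r \<Longrightarrow> c \<in> supported_on (cells V)"
  by (auto simp: chains_def supported_on_def)

lemma cycles_cells: "c \<in> cycles r \<Longrightarrow> c \<in> supported_on (cells V)"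
  by (auto simp: cycles_def intro: chains_cells)

lemma cell_diff_chains: "b \<in> chains r \<Longrightarrow> cell_diff b \<in> supported_on (cells V)"
  by (rule cell_diff_supported_on_cells[OF chains_cells])

lemma koszul_chains_eq: "koszul_chains V M r = to_koszul ` chains r"
proof (intro equalityI subsetI)
  fix f assume f: "f \<in> koszul_chains V M r"
  then have "f \<in> carrier (koszul V M)"
    unfolding koszul_chains_def by blast
  then obtain c where c: "c \<in> supported_on (cells V)" "f = to_koszul c"
    unfolding koszul_carrier by blast
  \<comment> \<open>A lift of an \<open>r\<close>-chain may have terms in other degrees, with
    coefficients in \<open>I\<close>. The projection discards them without changing the
    image.\<close>
  have restr: "restr (degree_cells r) c \<in> chains r"
    using restr_supported_on[OF c(1), of "degree_cells r"] by (simp add: chains_def Int_commute)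
  have "I +>\<^bsub>R\<^esub> coefficient L (restr (degree_cells r) c) = I +>\<^bsub>R\<^esub> coefficient L c" if "L \<in> Pow V" for L
  proof (cases "card L = r")
    case True
    then have "coefficient L (restr (degree_cells r) c) = coefficient L c"
      by (intro poly_mapping_eqI) (simp add: lookup_coefficient lookup_restr degree_cells_def)
    then show ?thesis
      by simp
  next
    case False
    then have "coefficient L (restr (degree_cells r) c) = 0"
      by (intro poly_mapping_eqI) (simp add: lookup_coefficient lookup_restr degree_cells_def)
    moreover have "I +>\<^bsub>R\<^esub> coefficient L c = I +>\<^bsub>R\<^esub> 0"
      using f False that by (auto simp: koszul_chains_def c(2) to_koszul_def quot_zero)
    ultimately show ?thesis
      by simp
  qed
  then have "f = to_koszul (restr (degree_cells r) c)"
    unfolding c(2) to_koszul_def by (intro restrict_ext) simp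
  then show "f \<in> to_koszul ` chains r"
    using restr by blast
next
  fix f assume "f \<in> to_koszul ` chains r"
  then obtain c where c: "c \<in> chains r" "f = to_koszul c"
    by blast
  have "coefficient L c = 0" if "card L \<noteq> r" for L
    using c(1) that by (intro poly_mapping_eqI)
      (auto simp: lookup_coefficient chains_def supported_on_iff degree_cells_def)
  then have "\<forall>L\<in>Pow V. card L \<noteq> r \<longrightarrow> f L = \<zero>\<^bsub>M\<^esub>"
    by (simp add: c(2) to_koszul_def quot_zero)
  moreover have "f \<in> carrier (koszul V M)"
    unfolding c(2) koszul_carrier using chains_cells[OF c(1)] by blast
  ultimately show "f \<in> koszul_chains V M r"
    by (simp add: koszul_chains_def)
qed

lemma koszul_cycles_eq: "koszul_cycles R V mvar M r = to_koszul ` cycles r"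
proof -
  have "koszul_diff R V mvar M (to_koszul c) = \<zero>\<^bsub>koszul V M\<^esub> \<longleftrightarrow> cell_diff c \<in> supported_on (ideal_cells \<F>)"
    if "c \<in> chains r" for c
    using chains_cells[OF that] to_koszul_eq_iff[OF cell_diff_chains[OF that] supported_on_zero]
    by (simp add: koszul_diff_to_koszul koszul_zero)
  then show ?thesis
    unfolding koszul_cycles_def koszul_chains_eq cycles_def by blast
qed

lemma koszul_boundaries_eq:
  "koszul_boundaries R V mvar M r = to_koszul ` cell_diff ` chains (Suc r)"
  unfolding koszul_boundaries_def koszul_chains_eq image_image
  by (intro image_cong refl koszul_diff_to_koszul chains_cells)

definition cell_class :: "nat \<Rightarrow> ('v cell \<Rightarrow>\<^sub>0 'k) \<Rightarrow> ('v set \<Rightarrow> ('v, 'k) mpoly set) set" where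
  "cell_class r c = {to_koszul (cell_diff b + c) | b. b \<in> chains (Suc r)}"

lemma boundary_coset:
  assumes "c \<in> supported_on (cells V)"
  shows "koszul_boundaries R V mvar M r +>\<^bsub>koszul V M\<^esub> to_koszul c = cell_class r c"
proof -
  have "to_koszul (cell_diff b) \<oplus>\<^bsub>koszul V M\<^esub> to_koszul c = to_koszul (cell_diff b + c)"
    if "b \<in> chains (Suc r)" for b
    by (rule koszul_add[OF cell_diff_chains[OF that] assms])
  then show ?thesis
    unfolding a_r_coset_def' koszul_boundaries_eq cell_class_def by auto
qed

lemma homology_class_to_koszul:
  "c \<in> supported_on (cells V) \<Longrightarrow> homology_class V I r (to_koszul c) = cell_class r c"
  unfolding homology_class_def koszul_class_def by (rule boundary_coset)

lemma chains_add: "b \<in> chains r \<Longrightarrow> c \<in> chains r \<Longrightarrow> b + c \<in> chains r"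
  unfolding chains_def by (rule supported_on_add)

lemma chains_diff: "b \<in> chains r \<Longrightarrow> c \<in> chains r \<Longrightarrow> b - c \<in> chains r"
  unfolding chains_def by (rule supported_on_diff)

lemma chains_zero: "0 \<in> chains r"
  by (simp add: chains_def)

lemma chains_scale: "c \<in> chains r \<Longrightarrow> scale s c \<in> chains r"
  unfolding chains_def by (rule supported_on_scale)

text \<open>This is the form in which the spanning theorem delivers its result: a difference that is
  a boundary up to coefficients in \<open>I\<close>.\<close>

lemma cell_class_cong:
  assumes c: "c \<in> supported_on (cells V)" and d: "d \<in> supported_on (cells V)" and b: "b \<in> chains (Suc r)"
    and eq: "c - d - cell_diff b \<in> supported_on (ideal_cells \<F>)"
  shows "cell_class r c = cell_class r d"
proof -
  have *: "cell_class r c \<subseteq> cell_class r d"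
    if "c \<in> supported_on (cells V)" "d \<in> supported_on (cells V)" "b \<in> chains (Suc r)"
      "c - d - cell_diff b \<in> supported_on (ideal_cells \<F>)" for c d b
  proof
    fix f assume "f \<in> cell_class r c"
    then obtain b' where b': "b' \<in> chains (Suc r)" "f = to_koszul (cell_diff b' + c)"
      by (auto simp: cell_class_def)
    have "cell_diff b' + c - (cell_diff (b' + b) + d) = c - d - cell_diff b"
      by (simp add: cell_diff_add)
    then have "cell_diff b' + c - (cell_diff (b' + b) + d) \<in> supported_on (ideal_cells \<F>)"
      using that(4) by (simp only:)
    then have "f = to_koszul (cell_diff (b' + b) + d)"
      unfolding b'(2) using that(1-3) b'(1)
      by (intro to_koszul_eq_iff[THEN iffD2]) (auto intro: supported_on_add cell_diff_chains chains_add)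
    then show "f \<in> cell_class r d"
      using chains_add[OF b'(1) that(3)] by (auto simp: cell_class_def)
  qed
  \<comment> \<open>The hypothesis is symmetric in \<open>c\<close> and \<open>d\<close> when
    \<open>b\<close> is negated, so one inclusion of classes gives both.\<close>
  have "d - c - cell_diff (0 - b) = - (c - d - cell_diff b)"
    by (simp add: cell_diff_diff cell_diff_zero additive.minus[OF additive_cell_diff])
  then have "d - c - cell_diff (0 - b) \<in> supported_on (ideal_cells \<F>)"
    using eq by (simp only: supported_on_uminus)
  from *[OF d c chains_diff[OF chains_zero b] this] *[OF c d b eq] show ?thesis
    by blast
qed

lemma homology_carrier: "carrier (homology_space V I r) = cell_class r ` cycles r"
proof -
  have "carrier (homology_space V I r) = (\<lambda>c. koszul_boundaries R V mvar M r +>\<^bsub>koszul V M\<^esub> c) ` to_koszul ` cycles r"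
    by (auto simp: homology_space_def restrict_scalars_def koszul_homology_def quotient_module_def
        A_RCOSETS_def' a_r_coset_def' koszul_cycles_eq)
  also have "\<dots> = cell_class r ` cycles r"
    unfolding image_image by (intro image_cong refl boundary_coset cycles_cells)
  finally show ?thesis .
qed

lemma homology_zero: "\<zero>\<^bsub>homology_space V I r\<^esub> = cell_class r 0"
  by (auto simp: homology_space_def restrict_scalars_def koszul_homology_def quotient_module_def
      koszul_boundaries_eq cell_class_def)

lemma homology_add:
  assumes "c \<in> cycles r" "d \<in> cycles r"
  shows "cell_class r c \<oplus>\<^bsub>homology_space V I r\<^esub> cell_class r d = cell_class r (c + d)"
proof -
  have sum: "to_koszul (cell_diff b + c) \<oplus>\<^bsub>koszul V M\<^esub> to_koszul (cell_diff b' + d)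
      = to_koszul (cell_diff (b + b') + (c + d))" if "b \<in> chains (Suc r)" "b' \<in> chains (Suc r)" for b b'
  proof -
    have eq: "cell_diff b + c + (cell_diff b' + d) = cell_diff (b + b') + (c + d)"
      by (simp add: cell_diff_add ac_simps)
    show ?thesis
      unfolding eq[symmetric]
      by (rule koszul_add[OF supported_on_add[OF cell_diff_chains[OF that(1)] cycles_cells[OF assms(1)]]
            supported_on_add[OF cell_diff_chains[OF that(2)] cycles_cells[OF assms(2)]]])
  qed
  have "cell_class r c \<oplus>\<^bsub>homology_space V I r\<^esub> cell_class r d
      = (\<Union>f\<in>cell_class r c. \<Union>g\<in>cell_class r d. {f \<oplus>\<^bsub>koszul V M\<^esub> g})"
    unfolding homology_space_def restrict_scalars_def koszul_homology_def quotient_module_def set_add_def'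
    by simp
  also have "\<dots> = cell_class r (c + d)"
  proof (intro equalityI subsetI)
    fix h assume "h \<in> (\<Union>f\<in>cell_class r c. \<Union>g\<in>cell_class r d. {f \<oplus>\<^bsub>koszul V M\<^esub> g})"
    then obtain b b' where b: "b \<in> chains (Suc r)" "b' \<in> chains (Suc r)"
      and h: "h = to_koszul (cell_diff b + c) \<oplus>\<^bsub>koszul V M\<^esub> to_koszul (cell_diff b' + d)"
      unfolding cell_class_def by blast
    show "h \<in> cell_class r (c + d)"
      unfolding h sum[OF b] cell_class_def using chains_add[OF b] by blast
  next
    fix h assume "h \<in> cell_class r (c + d)"
    then obtain b where b: "b \<in> chains (Suc r)" and h: "h = to_koszul (cell_diff b + (c + d))"
      unfolding cell_class_def by blast
    have "h = to_koszul (cell_diff b + c) \<oplus>\<^bsub>koszul V M\<^esub> to_koszul (cell_diff 0 + d)"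
      unfolding sum[OF b chains_zero] h by simp
    then show "h \<in> (\<Union>f\<in>cell_class r c. \<Union>g\<in>cell_class r d. {f \<oplus>\<^bsub>koszul V M\<^esub> g})"
      unfolding cell_class_def using b chains_zero by blast
  qed
  finally show ?thesis .
qed

text \<open>A scalar multiple in the quotient module is a union over representatives. All of them
  yield the same class, and the union is nonempty since 0 is a chain.\<close>

lemma homology_smult:
  assumes c: "c \<in> cycles r"
  shows "s \<odot>\<^bsub>homology_space V I r\<^esub> cell_class r c = cell_class r (scale s c)"
proof -
  have "s \<odot>\<^bsub>homology_space V I r\<^esub> cell_class r c
      = (\<Union>f\<in>cell_class r c. koszul_boundaries R V mvar M r +>\<^bsub>koszul V M\<^esub> (mconst s \<odot>\<^bsub>koszul V M\<^esub> f))"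
    by (simp add: homology_space_def restrict_scalars_def koszul_homology_def quotient_module_def a_r_coset_def')
  also have "\<dots> = (\<Union>b\<in>chains (Suc r). koszul_boundaries R V mvar M r +>\<^bsub>koszul V M\<^esub>
      (mconst s \<odot>\<^bsub>koszul V M\<^esub> to_koszul (cell_diff b + c)))"
    by (auto simp: cell_class_def)
  also have "\<dots> = (\<Union>b\<in>chains (Suc r). cell_class r (scale s c))"
  proof (intro SUP_cong refl)
    fix b assume b: "b \<in> chains (Suc r)"
    have cells: "cell_diff b + c \<in> supported_on (cells V)"
      using b c by (intro supported_on_add cell_diff_chains cycles_cells)
    have "cell_class r (scale s (cell_diff b + c)) = cell_class r (scale s c)"
    proof (rule cell_class_cong[OF _ _ chains_scale[OF b]])
      show "scale s (cell_diff b + c) - scale s c - cell_diff (scale s b) \<in> supported_on (ideal_cells \<F>)"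
        by (simp add: scale.scale_right_distrib cell_diff_scale)
    qed (use cells cycles_cells[OF c] in \<open>auto intro: supported_on_scale\<close>)
    then show "koszul_boundaries R V mvar M r +>\<^bsub>koszul V M\<^esub> (mconst s \<odot>\<^bsub>koszul V M\<^esub> to_koszul (cell_diff b + c))
        = cell_class r (scale s c)"
      using cells by (simp add: koszul_smult boundary_coset supported_on_scale)
  qed
  also have "\<dots> = cell_class r (scale s c)"
    using chains_zero by auto
  finally show ?thesis .
qed

lemma subspace_cycles: "module.subspace scale (cycles r)"
  unfolding scale.subspace_def cycles_def
  by (auto simp: chains_zero chains_add chains_scale cell_diff_zero cell_diff_add cell_diff_scale
      intro: supported_on_add supported_on_scale)

text \<open>Lifts of the monomial cycles of degree \<open>r\<close>; coefficient 1 is enough, as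
  scalars are supplied by the span.\<close>

definition monomial_cells :: "nat \<Rightarrow> ('v cell \<Rightarrow>\<^sub>0 'k) set" where
  "monomial_cells r = (\<lambda>k. single k 1) ` (cells V \<inter> degree_cells r \<inter> cycle_cells \<F>)"

lemma monomial_cells_cycles: "monomial_cells r \<subseteq> cycles r"
proof -
  have "cell_diff (single (a, L) 1 :: 'v cell \<Rightarrow>\<^sub>0 'k) \<in> supported_on (ideal_cells \<F>)"
    if "(a, L) \<in> cycle_cells \<F>" for a L
    unfolding cell_diff_single using that
    by (intro supported_on_sum supported_on_single) (auto simp: cycle_cells_def ideal_cells_def)
  then show ?thesis
    by (auto simp: monomial_cells_def cycles_def chains_def)
qed

lemma monomial_cells_homology_class:
  "cell_class r ` monomial_cells r \<subseteq> homology_class V I r ` monomial_cycles V I r"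
proof -
  have "cell_class r (single (a, L) 1) \<in> homology_class V I r ` monomial_cycles V I r"
    if k: "(a, L) \<in> cells V \<inter> degree_cells r \<inter> cycle_cells \<F>" for a L
  proof -
    have cycle: "single (a, L) 1 \<in> cycles r"
      using monomial_cells_cycles k by (auto simp: monomial_cells_def)
    have elem: "to_koszul (single (a, L) 1) = koszul_elem V M (I +>\<^bsub>R\<^esub> mmonomial a) L"
      unfolding to_koszul_def koszul_elem_def
      by (intro restrict_ext) (simp add: coefficient_single quot_zero mmonomial_def)
    have "to_koszul (single (a, L) 1) \<in> koszul_cycles R V mvar M r"
      using cycle by (simp add: koszul_cycles_eq)
    then have "to_koszul (single (a, L) 1) \<in> monomial_cycles V I r"
      using k unfolding monomial_cycles_def elem by (auto simp: cells_def degree_cells_def)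
    then show ?thesis
      using homology_class_to_koszul[OF cycles_cells[OF cycle]] by (metis imageI)
  qed
  then show ?thesis
    by (auto simp: monomial_cells_def)
qed

lemma cycle_class_in_span:
  assumes "leafy \<F>" "\<F> \<subseteq> Pow V" and c: "c \<in> cycles r"
  shows "\<exists>z\<in>scale.span (monomial_cells r). cell_class r c = cell_class r z"
proof -
  have cells: "c \<in> supported_on (cells V)" and degree: "restr (degree_cells r) c = c"
    using c by (auto simp: cycles_def chains_def supported_on_def intro: restr_id)
  obtain z b where z: "z \<in> supported_on (cells V \<inter> cycle_cells \<F>)" and b: "b \<in> supported_on (cells V)"
    and eq: "c - z - cell_diff b \<in> supported_on (ideal_cells \<F>)"
    using monomial_cycles_span_cells[OF V assms(2,1) cells] c by (auto simp: cycles_def)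
  \<comment> \<open>\<open>c\<close> is homogeneous of degree \<open>r\<close>, so the relation
    persists when \<open>z\<close> is projected to degree \<open>r\<close> and \<open>b\<close> to
    degree \<open>Suc r\<close>; projecting keeps the monomial cycles of \<open>z\<close> in that
    degree.\<close>
  let ?z = "restr (degree_cells r) z" and ?b = "restr (degree_cells (Suc r)) b"
  have "c - ?z - cell_diff ?b = restr (degree_cells r) (c - z - cell_diff b)"
    by (simp add: cell_diff_degree[OF b V] additive.diff[OF additive_restr] degree)
  also have "\<dots> \<in> supported_on (ideal_cells \<F>)"
    by (rule supported_on_mono[OF restr_supported_on[OF eq]]) simp
  finally have "c - ?z - cell_diff ?b \<in> supported_on (ideal_cells \<F>)" .
  moreover have z': "?z \<in> supported_on (cells V \<inter> degree_cells r \<inter> cycle_cells \<F>)"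
    by (rule supported_on_mono[OF restr_supported_on[OF z]]) auto
  moreover have "?b \<in> chains (Suc r)"
    unfolding chains_def by (rule supported_on_mono[OF restr_supported_on[OF b]]) auto
  ultimately have "cell_class r c = cell_class r ?z"
    using cells by (intro cell_class_cong) (auto simp: supported_on_def)
  moreover have "(\<Sum>k\<in>keys ?z. scale (lookup ?z k) (single k 1)) \<in> scale.span (monomial_cells r)"
    using z' by (intro scale.span_sum scale.span_scale scale.span_base)
      (auto simp: supported_on_def monomial_cells_def)
  then have "?z \<in> scale.span (monomial_cells r)"
    by (simp add: scale_single flip: poly_mapping_sum_single)
  ultimately show ?thesis
    by blast
qed

theorem basis_of_monomial_cycles:
  assumes "leafy \<F>" "\<F> \<subseteq> Pow V"
  shows "\<exists>B \<subseteq> homology_class V I r ` monomial_cycles V I r.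
    vectorspace.basis (ring_of_type_algebra :: 'k ring) (homology_space V I r) B"
proof -
  have "\<exists>B\<subseteq>cell_class r ` monomial_cells r.
      vectorspace.basis (ring_of_type_algebra :: 'k ring) (homology_space V I r) B"
    by (rule basis_in_image[OF vector_space_scale subspace_cycles homology_carrier homology_zero
          homology_add homology_smult monomial_cells_cycles cycle_class_in_span[OF assms]])
  then show ?thesis
    using monomial_cells_homology_class by (meson order_trans)
qed

end

theorem proposition2p9:
  fixes \<Delta> :: "nat set set" and n r :: nat and I :: "(nat, 'k::field) mpoly set"
  assumes "simplicial_forest {1..n} \<Delta>"
    and "I = facet_ideal {1..n} \<Delta>"
  shows "\<exists>B \<subseteq> homology_class {1..n} I r ` monomial_cycles {1..n} I r.
           vectorspace.basis (ring_of_type_algebra :: 'k ring) (homology_space {1..n} I r) B"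
proof -
  have sub: "facets \<Delta> \<subseteq> Pow {1..n}"
    using assms(1) by (auto simp: simplicial_forest_def simplicial_complex_def facets_def)
  have "I = monomial_ideal {1..n} (facets \<Delta>)"
    unfolding assms(2) by (rule facet_ideal_eq[OF _ sub]) simp
  then interpret monomial_quotient "{1..n}" "facets \<Delta>" I
    by unfold_locales simp_all
  show ?thesis
    by (rule basis_of_monomial_cycles[OF leafy_facets_of_forest[OF assms(1)] sub])
qed

end
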